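(* Let $\omega$ be an outer commutator word and let $G$ be a group. Suppose that the set $G_\omega$ of values of $\omega$ in $G$ is finite, with $|G_\omega|=m$. Then: (i) if $G$ is soluble, $|\omega(G)|\le 2^{m-1}$; (ii) if $G$ is not soluble, $|\omega(G)|\le (m-1)^{m-1}$.
   Context: A word $\omega$ is an element of a free group on a set of indeterminates $x_1,x_2,\ldots$. If $\omega$ involves the indeterminates $x_1,\dots,x_k$, then for a group $G$ the set of values of $\omega$ in $G$ is $G_\omega=\{\omega(g_1,\ldots,g_k)\mid g_1,\dots,g_k\in G\}$, and the verbal subgroup $\omega(G)$ is the subgroup of $G$ generated by $G_\omega$. Commutators are $[x,y]=x^{-1}y^{-1}xy$. Outer commutator words are defined recursively: every indeterminate is an outer commutator word; and if $\alpha,\beta$ are outer commutator words whose sets of indeterminates are disjoint, then $[\alpha,\beta]$ is an outer commutator word. Words differing only by renaming the indeterminates are called equivalent; they have the same values and the same verbal subgroup. *)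

theory Defs
  imports "HOL-Algebra.Solvable_Groups"
begin

text \<open>A letter \<open>(i, True)\<close> stands for the indeterminate \<open>x\<^sub>i\<close> and \<open>(i, False)\<close> for its inverse. Elements of the
  free group are represented by reduced words, so that the indeterminates involved in an
  element can be read off from its letters.\<close>

type_synonym letter = "nat \<times> bool"

definition reduced :: "letter list \<Rightarrow> bool" where
  "reduced = successively (\<lambda>a b. fst a = fst b \<longrightarrow> snd a = snd b)"

definition flip_letter :: "letter \<Rightarrow> letter" where
  "flip_letter a = (fst a, \<not> snd a)"

fun push_letter :: "letter \<Rightarrow> letter list \<Rightarrow> letter list" where
  "push_letter a [] = [a]"
| "push_letter a (b # w) = (if a = flip_letter b then w else a # b # w)"

definition free_group :: "letter list monoid" where
  "free_group = \<lparr>carrier = {w. reduced w}, monoid.mult = foldr push_letter, one = []\<rparr>"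

lemma flip_flip [simp]: "flip_letter (flip_letter a) = a"
  by (simp add: flip_letter_def)

lemma flip_eq_iff [simp]: "flip_letter a = flip_letter b \<longleftrightarrow> a = b"
  by (cases a; cases b) (auto simp: flip_letter_def)

lemma flip_neq [simp]: "flip_letter a \<noteq> a" "a \<noteq> flip_letter a"
  by (cases a; simp add: flip_letter_def)+

lemma reduced_Nil [simp]: "reduced []"
  by (simp add: reduced_def)

lemma reduced_Cons: "reduced (a # w) \<longleftrightarrow> (w = [] \<or> a \<noteq> flip_letter (hd w)) \<and> reduced w"
  by (cases a; cases w) (auto simp: reduced_def flip_letter_def)

lemma reduced_push: "reduced w \<Longrightarrow> reduced (push_letter a w)"
  by (cases w) (auto simp: reduced_Cons)

lemma reduced_mult: "reduced v \<Longrightarrow> reduced (foldr push_letter u v)"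
  by (induction u) (auto simp: reduced_push)

lemma push_flip: "reduced w \<Longrightarrow> push_letter a (push_letter (flip_letter a) w) = w"
  by (cases w; cases "tl w") (auto simp: reduced_Cons)

lemma foldr_push:
  "reduced w \<Longrightarrow> foldr push_letter (push_letter a v) w = push_letter a (foldr push_letter v w)"
  using push_flip[of "foldr push_letter (tl v) w" "flip_letter (hd v)"]
  by (cases v) (auto simp: push_flip reduced_mult)

lemma foldr_mult:
  "reduced w \<Longrightarrow>
    foldr push_letter (foldr push_letter u v) w = foldr push_letter u (foldr push_letter v w)"
  by (induction u) (auto simp: foldr_push)

lemma foldr_push_Nil: "reduced w \<Longrightarrow> foldr push_letter w [] = w"
proof (induction w)
  case (Cons a w)
  then show ?case by (cases w) (auto simp: reduced_Cons)
qed simp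

lemma reduced_inverse: "reduced w \<Longrightarrow> reduced (rev (map flip_letter w))"
  unfolding reduced_def successively_rev successively_map
  by (erule successively_mono) (auto simp: flip_letter_def)

lemma foldr_inverse: "foldr push_letter (rev (map flip_letter w)) w = []"
  by (induction w) auto

lemma group_free_group: "group free_group"
proof (rule groupI)
  fix w assume "w \<in> carrier free_group"
  then show "\<exists>v\<in>carrier free_group. v \<otimes>\<^bsub>free_group\<^esub> w = \<one>\<^bsub>free_group\<^esub>"
    by (intro bexI[of _ "rev (map flip_letter w)"])
      (auto simp: free_group_def foldr_inverse reduced_inverse)
qed (auto simp: free_group_def reduced_mult foldr_mult)

lemma inv_free_group:
  assumes "w \<in> carrier free_group"
  shows "inv\<^bsub>free_group\<^esub> w = rev (map flip_letter w)"
  using assms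
  by (intro group.inv_equality[OF group_free_group])
    (auto simp: free_group_def foldr_inverse reduced_inverse)

text \<open>The convention \<open>[x, y] = x\<inverse> y\<inverse> x y\<close> differs from the one underlying
  \<^const>\<open>derived\<close>, which is \<open>x y x\<inverse> y\<inverse>\<close>.\<close>

definition commutator :: "('a, 'b) monoid_scheme \<Rightarrow> 'a \<Rightarrow> 'a \<Rightarrow> 'a" where
  "commutator G x y = inv\<^bsub>G\<^esub> x \<otimes>\<^bsub>G\<^esub> inv\<^bsub>G\<^esub> y \<otimes>\<^bsub>G\<^esub> x \<otimes>\<^bsub>G\<^esub> y"

definition indeterminates :: "letter list \<Rightarrow> nat set" where
  "indeterminates w = fst ` set w"

inductive outer_commutator_word :: "letter list \<Rightarrow> bool" where
  indeterminate: "outer_commutator_word [(i, True)]"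
| commutator: "\<lbrakk>outer_commutator_word \<alpha>; outer_commutator_word \<beta>;
    indeterminates \<alpha> \<inter> indeterminates \<beta> = {}\<rbrakk>
    \<Longrightarrow> outer_commutator_word (commutator free_group \<alpha> \<beta>)"

lemma outer_commutator_word_in_free_group:
  "outer_commutator_word \<omega> \<Longrightarrow> \<omega> \<in> carrier free_group"
proof (induction rule: outer_commutator_word.induct)
  case (indeterminate i)
  then show ?case by (simp add: free_group_def reduced_Cons)
next
  case (commutator \<alpha> \<beta>)
  interpret F: group free_group by (rule group_free_group)
  show ?case using commutator.IH by (simp add: commutator_def)
qed

definition letter_value :: "('a, 'b) monoid_scheme \<Rightarrow> (nat \<Rightarrow> 'a) \<Rightarrow> letter \<Rightarrow> 'a" where
  "letter_value G g a = (if snd a then g (fst a) else inv\<^bsub>G\<^esub> g (fst a))"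

definition word_value :: "('a, 'b) monoid_scheme \<Rightarrow> letter list \<Rightarrow> (nat \<Rightarrow> 'a) \<Rightarrow> 'a" where
  "word_value G w g = foldr (\<lambda>a x. letter_value G g a \<otimes>\<^bsub>G\<^esub> x) w \<one>\<^bsub>G\<^esub>"

definition word_values :: "('a, 'b) monoid_scheme \<Rightarrow> letter list \<Rightarrow> 'a set" where
  "word_values G w = {word_value G w g | g. \<forall>i\<in>indeterminates w. g i \<in> carrier G}"

definition verbal_subgroup :: "('a, 'b) monoid_scheme \<Rightarrow> letter list \<Rightarrow> 'a set" where
  "verbal_subgroup G w = generate G (word_values G w)"

context group
begin

lemma letter_value_closed: "range g \<subseteq> carrier G \<Longrightarrow> letter_value G g a \<in> carrier G"
  by (auto simp: letter_value_def)

lemma word_value_closed: "range g \<subseteq> carrier G \<Longrightarrow> word_value G w g \<in> carrier G"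
  by (induction w) (auto simp: word_value_def letter_value_closed)

lemma word_value_push:
  assumes "range g \<subseteq> carrier G"
  shows "word_value G (push_letter a w) g = letter_value G g a \<otimes> word_value G w g"
proof (cases w)
  case Nil
  then show ?thesis by (simp add: word_value_def)
next
  case (Cons b v)
  have cl: "g i \<in> carrier G" for i using assms by auto
  have v: "foldr (\<lambda>a x. letter_value G g a \<otimes> x) v \<one> \<in> carrier G"
    using word_value_closed[OF assms, of v] by (simp add: word_value_def)
  have *: "letter_value G g (flip_letter b) \<otimes> letter_value G g b = \<one>"
    using cl by (simp add: letter_value_def flip_letter_def)
  show ?thesis
    using v letter_value_closed[OF assms] *
    by (auto simp: Cons word_value_def m_assoc[symmetric])
qed

lemma word_value_hom:
  assumes "range g \<subseteq> carrier G"
  shows "(\<lambda>w. word_value G w g) \<in> hom free_group G"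
proof (rule homI)
  fix u v
  show "word_value G (u \<otimes>\<^bsub>free_group\<^esub> v) g = word_value G u g \<otimes> word_value G v g"
  proof (induction u)
    case Nil
    then show ?case using word_value_closed[OF assms] by (simp add: free_group_def word_value_def)
  next
    case (Cons a u)
    have "word_value G (a # u) g = letter_value G g a \<otimes> word_value G u g"
      by (simp add: word_value_def)
    with Cons show ?case
      using word_value_closed[OF assms] letter_value_closed[OF assms]
      by (simp add: free_group_def word_value_push[OF assms] m_assoc)
  qed
qed (simp add: word_value_closed[OF assms])

end

end

theory Submission
  imports Defs "HOL-Algebra.Multiplicative_Group"
begin

text \<open>An outer commutator word is a binary tree. Assume first that \<open>G\<close> is soluble and that the word has a
  nontrivial value. Choose terms of the derived series for the leaves such that the resulting iterated
  commutator of subgroups is nontrivial, but becomes trivial as soon as one leaf moves to the next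
  term. If the deepest term \<open>A\<close> sits at some leaf, then the iterated commutator \<open>W\<close> lies in \<open>A\<close> and is
  centralized by \<open>A\<close>, and the word restricted to these terms is multiplicative in that leaf. So there
  is a value \<open>x \<noteq> 1\<close> that commutes with its conjugates and all of whose powers are values. Adjoining
  such elements one at a time, working modulo the subgroup already obtained, multiplies the order by
  some \<open>k \<le> 2\<^sup>k\<^sup>-\<^sup>1\<close> and uses up \<open>k - 1\<close> new values, which gives \<open>2\<^sup>m\<^sup>-\<^sup>1\<close>.

  In general let \<open>k\<close> be the height of the tree, so that all values of \<open>\<delta>\<^sub>k\<close> and of \<open>\<delta>\<^sub>k\<^sub>+\<^sub>1\<close> are values of
  the word. A nontrivial value \<open>d = [a, b]\<close> of \<open>\<delta>\<^sub>k\<^sub>+\<^sub>1\<close>, with \<open>a\<close> and \<open>b\<close> values of \<open>\<delta>\<^sub>k\<close>, has order at most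
  \<open>(m - 1)\<^sup>2\<close>, by transfer from \<open>\<langle>a, b\<rangle>\<close> into its centre. By Dietzmann's lemma the set \<open>D\<close> of these \<open>d\<close>,
  which is closed under inverses, generates a subgroup of order at most \<open>(m - 1)\<^sup>|\<^sup>D\<^sup>|\<close>; modulo this
  subgroup the soluble case applies.\<close>

section \<open>Commutator calculus\<close>

context group
begin

abbreviation com :: "'a \<Rightarrow> 'a \<Rightarrow> 'a" where "com \<equiv> commutator G"

lemma mult_inv_cancel [simp]:
  assumes "x \<in> carrier G" "y \<in> carrier G"
  shows "inv x \<otimes> (x \<otimes> y) = y" "x \<otimes> (inv x \<otimes> y) = y"
  using assms by (simp_all add: m_assoc[symmetric])

lemma com_closed [simp]: "x \<in> carrier G \<Longrightarrow> y \<in> carrier G \<Longrightarrow> com x y \<in> carrier G"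
  by (simp add: commutator_def)

lemma inv_com: "x \<in> carrier G \<Longrightarrow> y \<in> carrier G \<Longrightarrow> inv (com x y) = com y x"
  by (simp add: commutator_def inv_mult_group m_assoc)

text \<open>The deviation from multiplicativity is the double commutator
  \<open>com (com x z) y\<close> rather than a conjugate, so it can be placed in a normal
  subgroup.\<close>

lemma com_mult_left:
  assumes "x \<in> carrier G" "y \<in> carrier G" "z \<in> carrier G"
  shows "com (x \<otimes> y) z = com x z \<otimes> (com (com x z) y \<otimes> com y z)"
  using assms by (simp add: commutator_def inv_mult_group m_assoc)

lemma com_mult_right:
  assumes "x \<in> carrier G" "y \<in> carrier G" "z \<in> carrier G"
  shows "com x (y \<otimes> z) = com x z \<otimes> (com x y \<otimes> com (com x y) z)"
  using assms by (simp add: commutator_def inv_mult_group m_assoc)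

lemma com_conj:
  assumes "x \<in> carrier G" "y \<in> carrier G" "g \<in> carrier G"
  shows "inv g \<otimes> com x y \<otimes> g = com (inv g \<otimes> x \<otimes> g) (inv g \<otimes> y \<otimes> g)"
  using assms by (simp add: commutator_def inv_mult_group m_assoc)

lemma conj_eq_mult_com:
  assumes "x \<in> carrier G" "g \<in> carrier G"
  shows "inv g \<otimes> x \<otimes> g = x \<otimes> com x g"
  using assms by (simp add: commutator_def m_assoc)

lemma com_eq_one_iff:
  assumes "x \<in> carrier G" "y \<in> carrier G"
  shows "com x y = \<one> \<longleftrightarrow> x \<otimes> y = y \<otimes> x"
proof -
  have "com x y = inv (y \<otimes> x) \<otimes> (x \<otimes> y)"
    using assms by (simp add: commutator_def inv_mult_group m_assoc)
  then show ?thesis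
    using assms by (metis inv_closed inv_inv inv_equality l_inv m_closed)
qed

lemma com_one [simp]: "x \<in> carrier G \<Longrightarrow> com x \<one> = \<one>" "x \<in> carrier G \<Longrightarrow> com \<one> x = \<one>"
  by (simp_all add: commutator_def)

lemma com_in_normal:
  assumes "N \<lhd> G" "x \<in> carrier G" "y \<in> carrier G" "x \<in> N \<or> y \<in> N"
  shows "com x y \<in> N"
proof -
  interpret N: normal N G by fact
  have "com x y = inv x \<otimes> (inv y \<otimes> x \<otimes> y)" "com x y = (inv x \<otimes> inv y \<otimes> x) \<otimes> y"
    using assms by (simp_all add: commutator_def m_assoc)
  then show ?thesis
    using assms by (metis N.inv_op_closed1 N.m_closed N.m_inv_closed)
qed

lemma normal_conj_iff:
  assumes "N \<lhd> G" "x \<in> carrier G" "g \<in> carrier G"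
  shows "inv g \<otimes> x \<otimes> g \<in> N \<longleftrightarrow> x \<in> N"
proof
  interpret N: normal N G by fact
  assume "inv g \<otimes> x \<otimes> g \<in> N"
  then have "g \<otimes> (inv g \<otimes> x \<otimes> g) \<otimes> inv g \<in> N" using assms by (intro N.inv_op_closed2)
  then show "x \<in> N" using assms by (simp add: m_assoc)
qed (use assms in \<open>auto intro: normal.inv_op_closed1\<close>)

lemma subgroup_nat_pow_closed: "subgroup H G \<Longrightarrow> x \<in> H \<Longrightarrow> x [^] (n::nat) \<in> H"
  by (induction n) (auto simp: subgroup.one_closed subgroup.m_closed)

text \<open>For fixed \<open>z\<close>, the elements \<open>x\<close> that commute with \<open>z\<close> modulo \<open>Q\<close> form a subgroup.\<close>

lemma com_generate_left:
  assumes Q: "Q \<lhd> G" and A: "A \<subseteq> carrier G" and z: "z \<in> carrier G"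
    and com: "\<And>x. x \<in> A \<Longrightarrow> com x z \<in> Q" and x: "x \<in> generate G A"
  shows "com x z \<in> Q"
  using x
proof induction
  interpret Q: normal Q G by fact
  case one
  then show ?case using z by simp
next
  interpret Q: normal Q G by fact
  case (incl h)
  then show ?case by (rule com)
next
  interpret Q: normal Q G by fact
  case (inv h)
  with A have h: "h \<in> carrier G" by auto
  have "com (inv h) z = inv (inv (inv h) \<otimes> com h z \<otimes> inv h)"
    using h z by (simp add: commutator_def inv_mult_group m_assoc)
  then show ?case
    using Q.m_inv_closed[OF Q.inv_op_closed1[OF inv_closed[OF h] com[OF inv]]] by simp
next
  interpret Q: normal Q G by fact
  case (eng x y)
  then have "x \<in> carrier G" "y \<in> carrier G" 
    using generate_in_carrier[OF A] by blast+
  note xy = this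
  have "com (com x z) y \<in> Q"
    using eng xy z by (intro com_in_normal[OF Q]) auto
  with eng xy z show ?case
    by (simp only: com_mult_left Q.m_closed)
qed

text \<open>\<open>com_generate_left\<close> handles one argument; inverting the commutators moves
  the other argument to the left, where it applies again.\<close>

lemma com_generate:
  assumes Q: "Q \<lhd> G" and A: "A \<subseteq> carrier G" and B: "B \<subseteq> carrier G"
    and com: "\<And>x y. x \<in> A \<Longrightarrow> y \<in> B \<Longrightarrow> com x y \<in> Q"
    and x: "x \<in> generate G A" and y: "y \<in> generate G B"
  shows "com x y \<in> Q"
proof -
  interpret Q: normal Q G by fact
  have xc: "x \<in> carrier G" and yc: "y \<in> carrier G"
    using generate_in_carrier[OF A x] generate_in_carrier[OF B y] .
  have swap: "com u v \<in> Q" if "com v u \<in> Q" "u \<in> carrier G" "v \<in> carrier G" for u v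
    using that Q.m_inv_closed[of "com v u"] by (simp add: inv_com)
  have "com b x \<in> Q" if b: "b \<in> B" for b
  proof (rule swap)
    show "com x b \<in> Q" "b \<in> carrier G"
      using b B com_generate_left[OF Q A _ com x, of b] by blast+
  qed (rule xc)
  then have "com y x \<in> Q"
    by (rule com_generate_left[OF Q B xc _ y])
  then show ?thesis
    using xc yc by (rule swap)
qed

lemma normal_generate:
  assumes "A \<subseteq> carrier G" and "\<And>x g. x \<in> A \<Longrightarrow> g \<in> carrier G \<Longrightarrow> inv g \<otimes> x \<otimes> g \<in> A"
  shows "generate G A \<lhd> G"
proof (rule normal_generateI[OF assms(1)])
  fix h g assume "h \<in> A" "g \<in> carrier G"
  then show "g \<otimes> h \<otimes> inv g \<in> A" using assms(2)[of h "inv g"] by simp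
qed

definition com_subgroup :: "'a set \<Rightarrow> 'a set \<Rightarrow> 'a set" where
  "com_subgroup A B = generate G {com x y | x y. x \<in> A \<and> y \<in> B}"

lemma com_in_com_subgroup: "x \<in> A \<Longrightarrow> y \<in> B \<Longrightarrow> com x y \<in> com_subgroup A B"
  unfolding com_subgroup_def by (rule generate.incl) auto

lemma com_subgroup_normal:
  assumes "A \<lhd> G" "B \<lhd> G" shows "com_subgroup A B \<lhd> G"
  unfolding com_subgroup_def
proof (rule normal_generate, goal_cases)
  case 1
  have "A \<subseteq> carrier G" "B \<subseteq> carrier G"
    using assms by (auto dest!: normal_imp_subgroup subgroup.subset)
  then show ?case by (auto dest!: subsetD)
next
  case (2 x g)
  then obtain a b where ab: "a \<in> A" "b \<in> B" "x = com a b" by auto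
  have ab': "a \<in> carrier G" "b \<in> carrier G"
    using assms[THEN normal_imp_subgroup, THEN subgroup.subset] ab by auto
  have "inv g \<otimes> x \<otimes> g = com (inv g \<otimes> a \<otimes> g) (inv g \<otimes> b \<otimes> g)"
    using ab ab' 2 by (simp add: com_conj)
  moreover have "inv g \<otimes> a \<otimes> g \<in> A" "inv g \<otimes> b \<otimes> g \<in> B"
    using ab ab' 2 assms by (auto simp: normal_conj_iff)
  ultimately show ?case by blast
qed

lemma com_subgroup_minimal:
  assumes "subgroup Q G" "\<And>x y. x \<in> A \<Longrightarrow> y \<in> B \<Longrightarrow> com x y \<in> Q"
  shows "com_subgroup A B \<subseteq> Q"
  unfolding com_subgroup_def using assms by (intro generate_subgroup_incl) auto

end

section \<open>Values of commutator trees\<close>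

text \<open>Leaves are filled independently even if labels repeat, which mirrors the disjointness of
  indeterminates. A label only selects a set from a family: for \<open>vals\<close> it is
  irrelevant, later it is a position in the derived series.\<close>

datatype comm_tree = Leaf nat | Node comm_tree comm_tree

primrec tree_values :: "('a, 'b) monoid_scheme \<Rightarrow> (nat \<Rightarrow> 'a set) \<Rightarrow> comm_tree \<Rightarrow> 'a set" where
  "tree_values G N (Leaf i) = N i"
| "tree_values G N (Node s t) =
    {commutator G x y | x y. x \<in> tree_values G N s \<and> y \<in> tree_values G N t}"

text \<open>\<open>full n\<close> is the tree of the derived word \<open>\<delta>\<^sub>n\<close>.\<close>

primrec full :: "nat \<Rightarrow> comm_tree" where
  "full 0 = Leaf 0"
| "full (Suc n) = Node (full n) (full n)"

primrec leaves :: "comm_tree \<Rightarrow> nat set" where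
  "leaves (Leaf i) = {i}"
| "leaves (Node s t) = leaves s \<union> leaves t"

primrec unlabelled :: "comm_tree \<Rightarrow> comm_tree" where
  "unlabelled (Leaf i) = Leaf 0"
| "unlabelled (Node s t) = Node (unlabelled s) (unlabelled t)"

primrec label_sum :: "comm_tree \<Rightarrow> nat" where
  "label_sum (Leaf i) = i"
| "label_sum (Node s t) = label_sum s + label_sum t"

primrec leaf_count :: "comm_tree \<Rightarrow> nat" where
  "leaf_count (Leaf i) = 1"
| "leaf_count (Node s t) = leaf_count s + leaf_count t"

primrec increments :: "comm_tree \<Rightarrow> comm_tree set" where
  "increments (Leaf i) = {Leaf (Suc i)}"
| "increments (Node s t) = (\<lambda>s'. Node s' t) ` increments s \<union> Node s ` increments t"

lemma leaf_count_unlabelled: "leaf_count (unlabelled t) = leaf_count t"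
  by (induction t) auto

lemma leaves_unlabelled: "leaves (unlabelled t) = {0}"
  by (induction t) auto

lemma unlabelled_unlabelled: "unlabelled (unlabelled t) = unlabelled t"
  by (induction t) auto

lemma increments_unlabelled: "t' \<in> increments t \<Longrightarrow> unlabelled t' = unlabelled t"
  by (induction t arbitrary: t') auto

lemma increments_label_sum: "t' \<in> increments t \<Longrightarrow> label_sum t' = Suc (label_sum t)"
  by (induction t arbitrary: t') auto

lemma leaves_finite: "finite (leaves t)" "leaves t \<noteq> {}"
  by (induction t) auto

text \<open>Bounds the labellings among which one with maximal label sum is chosen.\<close>

lemma label_sum_le: "(\<And>i. i \<in> leaves t \<Longrightarrow> i \<le> n) \<Longrightarrow> label_sum t \<le> n * leaf_count t"
  by (induction t) (fastforce simp: distrib_left intro: add_mono)+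

lemma tree_values_unlabelled: "tree_values G (\<lambda>_. A) (unlabelled t) = tree_values G (\<lambda>_. A) t"
  by (induction t) auto

lemma tree_values_mono: "(\<And>i. i \<in> leaves t \<Longrightarrow> N i \<subseteq> M i) \<Longrightarrow> tree_values G N t \<subseteq> tree_values G M t"
  by (induction t) (simp; blast)+

context group
begin

abbreviation vals :: "comm_tree \<Rightarrow> 'a set" where
  "vals \<equiv> tree_values G (\<lambda>_. carrier G)"

abbreviation derived_term :: "nat \<Rightarrow> 'a set" where
  "derived_term i \<equiv> (derived G ^^ i) (carrier G)"

lemma tree_values_closed:
  assumes "\<And>i. N i \<subseteq> carrier G" shows "tree_values G N t \<subseteq> carrier G"
proof (induction t)
  case (Node s t)
  then show ?case by (auto dest!: subsetD)
qed (use assms in auto)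

lemma tree_values_conj:
  assumes N: "\<And>i. N i \<lhd> G" and x: "x \<in> tree_values G N t" and g: "g \<in> carrier G"
  shows "inv g \<otimes> x \<otimes> g \<in> tree_values G N t"
  using x
proof (induction t arbitrary: x)
  case (Leaf i)
  then show ?case using N[of i] g by (simp add: normal.inv_op_closed1)
next
  case (Node s t)
  have "tree_values G N u \<subseteq> carrier G" for u
    using N[THEN normal_imp_subgroup, THEN subgroup.subset] by (rule tree_values_closed)
  moreover obtain a b where ab: "a \<in> tree_values G N s" "b \<in> tree_values G N t" "x = com a b"
    using Node.prems by auto
  ultimately have "inv g \<otimes> x \<otimes> g = com (inv g \<otimes> a \<otimes> g) (inv g \<otimes> b \<otimes> g)"
    using g by (simp add: com_conj subset_iff)
  with Node.IH(1)[OF ab(1)] Node.IH(2)[OF ab(2)] show ?case by auto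
qed

lemma one_in_tree_values:
  assumes "\<And>i. subgroup (N i) G" shows "\<one> \<in> tree_values G N t"
proof (induction t)
  case (Leaf i)
  then show ?case using subgroup.one_closed[OF assms] by simp
next
  case (Node s t)
  then show ?case using com_one(1)[OF one_closed] by force
qed

lemma normal_carrier: "carrier G \<lhd> G"
  by (rule normal_self)

lemmas vals_closed = tree_values_closed[of "\<lambda>_. carrier G", OF subset_refl]
lemmas vals_conj = tree_values_conj[of "\<lambda>_. carrier G", OF normal_carrier]
lemmas one_in_vals = one_in_tree_values[of "\<lambda>_. carrier G", OF subgroup_self]

text \<open>The two commutator conventions are interchanged by inverting both arguments, which a
  subgroup permits.\<close>

lemma derived_eq_com_subgroup:
  assumes "subgroup H G" shows "derived G H = com_subgroup H H"
proof -
  interpret H: subgroup H G by fact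
  have "derived_set G H = {com x y | x y. x \<in> H \<and> y \<in> H}"
  proof (intro equalityI subsetI)
    fix z assume "z \<in> derived_set G H"
    then obtain h k where hk: "h \<in> H" "k \<in> H" "z = h \<otimes> k \<otimes> inv h \<otimes> inv k" by auto
    then have "z = com (inv h) (inv k)" by (simp add: commutator_def)
    with hk show "z \<in> {com x y | x y. x \<in> H \<and> y \<in> H}" by blast
  next
    fix z assume "z \<in> {com x y | x y. x \<in> H \<and> y \<in> H}"
    then obtain h k where hk: "h \<in> H" "k \<in> H" "z = com h k" by auto
    then have "z = inv h \<otimes> inv k \<otimes> inv (inv h) \<otimes> inv (inv k)" by (simp add: commutator_def)
    with hk show "z \<in> derived_set G H" by blast
  qed
  then show ?thesis by (simp add: derived_def com_subgroup_def)
qed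

lemma derived_term_normal: "derived_term i \<lhd> G"
  by (induction i) (auto simp: normal_self derived_is_normal)

lemmas derived_term_subgroup = derived_term_normal[THEN normal_imp_subgroup]
lemmas derived_term_closed = derived_term_subgroup[THEN subgroup.subset]

lemma derived_term_Suc: "derived_term (Suc i) = com_subgroup (derived_term i) (derived_term i)"
  using derived_eq_com_subgroup[OF derived_term_subgroup[of i]] by simp

lemma derived_term_antimono: "i \<le> j \<Longrightarrow> derived_term j \<subseteq> derived_term i"
proof (induction j rule: dec_induct)
  case (step n)
  have "derived_term (Suc n) \<subseteq> derived_term n"
    using derived_incl[OF subset_refl derived_term_subgroup[of n]] by simp
  with step show ?case by blast
qed simp

text \<open>By induction and \<open>com_generate\<close> only commutators of two values of
  \<open>full n\<close> need checking, and these are values of \<open>full (Suc n)\<close>.\<close>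

lemma derived_term_subset_generate_full: "derived_term n \<subseteq> generate G (vals (full n))"
proof (induction n)
  case 0
  then show ?case by (auto intro: generate.incl)
next
  case (Suc n)
  let ?Q = "generate G (vals (full (Suc n)))"
  have Q: "?Q \<lhd> G"
    using vals_closed vals_conj by (rule normal_generate)
  have "com x y \<in> ?Q" if "x \<in> derived_term n" "y \<in> derived_term n" for x y
  proof (rule com_generate[OF Q vals_closed vals_closed])
    show "x \<in> generate G (vals (full n))" "y \<in> generate G (vals (full n))"
      using that Suc by blast+
  qed (auto intro: generate.incl)
  then show ?case
    unfolding derived_term_Suc by (rule com_subgroup_minimal[OF normal_imp_subgroup[OF Q]])
qed

lemma vals_full_subset_derived_term: "vals (full n) \<subseteq> derived_term n"
proof (induction n)
  case (Suc n)
  then show ?case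
    unfolding derived_term_Suc by (auto intro!: com_in_com_subgroup)
qed simp

text \<open>The values of \<open>full n\<close> lie in the n-th derived term and generate a subgroup
  containing it. Solubility thus becomes a condition on values, which can be read modulo a normal
  subgroup.\<close>

lemma solvable_iff_full_values: "solvable G \<longleftrightarrow> (\<exists>n. vals (full n) \<subseteq> {\<one>})"
proof -
  have "derived_term n = {\<one>} \<longleftrightarrow> vals (full n) \<subseteq> {\<one>}" for n
  proof
    assume "vals (full n) \<subseteq> {\<one>}"
    then have "generate G (vals (full n)) \<subseteq> {\<one>}"
      using triv_subgroup by (intro generate_subgroup_incl)
    then show "derived_term n = {\<one>}"
      using derived_term_subset_generate_full[of n]
        subgroup.one_closed[OF derived_term_subgroup[of n]] by blast
  qed (use vals_full_subset_derived_term in auto)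
  then show ?thesis by (simp add: solvable_iff_trivial_derived_seq)
qed

end

section \<open>Values all of whose powers are values\<close>

context group
begin

primrec tree_subgroup :: "comm_tree \<Rightarrow> 'a set" where
  "tree_subgroup (Leaf i) = derived_term i"
| "tree_subgroup (Node s t) = com_subgroup (tree_subgroup s) (tree_subgroup t)"

text \<open>The subgroup generated by \<open>tree_subgroup t'\<close> for all \<open>t' \<in> increments t\<close>, given by recursion.\<close>

primrec tree_increment :: "comm_tree \<Rightarrow> 'a set" where
  "tree_increment (Leaf i) = derived_term (Suc i)"
| "tree_increment (Node s t) = generate G
    ({com x y | x y. x \<in> tree_increment s \<and> y \<in> tree_subgroup t} \<union>
     {com x y | x y. x \<in> tree_subgroup s \<and> y \<in> tree_increment t})"

lemma tree_subgroup_normal: "tree_subgroup t \<lhd> G"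
  by (induction t) (simp_all add: derived_term_normal com_subgroup_normal)

lemma tree_subgroup_closed: "tree_subgroup t \<subseteq> carrier G"
  using tree_subgroup_normal[of t] by (simp add: normal_imp_subgroup subgroup.subset)

lemma tree_increment_normal: "tree_increment t \<lhd> G"
proof (induction t)
  case (Leaf i)
  show ?case using derived_term_normal[of "Suc i"] by simp
next
  case (Node s t)
  note N = Node tree_subgroup_normal[of s] tree_subgroup_normal[of t]
  note C = N[THEN normal_imp_subgroup, THEN subgroup.subset, THEN subsetD]
  show ?case
    unfolding tree_increment.simps
  proof (rule normal_generate)
    fix z g
    assume z: "z \<in> {com x y | x y. x \<in> tree_increment s \<and> y \<in> tree_subgroup t} \<union>
      {com x y | x y. x \<in> tree_subgroup s \<and> y \<in> tree_increment t}" (is "_ \<in> ?A") and g: "g \<in> carrier G"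
    from z obtain x y where xy: "z = com x y"
      "x \<in> tree_increment s \<and> y \<in> tree_subgroup t \<or> x \<in> tree_subgroup s \<and> y \<in> tree_increment t"
      by auto
    then have xyc: "x \<in> carrier G" "y \<in> carrier G" using C by blast+
    have "inv g \<otimes> z \<otimes> g = com (inv g \<otimes> x \<otimes> g) (inv g \<otimes> y \<otimes> g)"
      using xy xyc g by (simp add: com_conj)
    moreover from xy(2) have
      "inv g \<otimes> x \<otimes> g \<in> tree_increment s \<and> inv g \<otimes> y \<otimes> g \<in> tree_subgroup t \<or>
       inv g \<otimes> x \<otimes> g \<in> tree_subgroup s \<and> inv g \<otimes> y \<otimes> g \<in> tree_increment t"
      using N xyc g by (simp add: normal_conj_iff)
    ultimately show "inv g \<otimes> z \<otimes> g \<in> ?A" by blast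
  qed (use C in auto)
qed

lemma tree_increment_closed: "tree_increment t \<subseteq> carrier G"
  using tree_increment_normal[of t] by (simp add: normal_imp_subgroup subgroup.subset)

lemma com_in_tree_increment:
  "x \<in> tree_increment s \<Longrightarrow> y \<in> tree_subgroup t \<Longrightarrow> com x y \<in> tree_increment (Node s t)"
  "x \<in> tree_subgroup s \<Longrightarrow> y \<in> tree_increment t \<Longrightarrow> com x y \<in> tree_increment (Node s t)"
  by (auto intro!: generate.incl)

lemma com_in_tree_increment_swap_right:
  assumes "x \<in> tree_subgroup s" "y \<in> tree_increment t"
  shows "com y x \<in> tree_increment (Node s t)"
proof -
  have "x \<in> carrier G" "y \<in> carrier G"
    using assms tree_subgroup_closed tree_increment_closed by auto
  then show ?thesis
    using subgroup.m_inv_closed[OF normal_imp_subgroup[OF tree_increment_normal] com_in_tree_increment(2)[OF assms]]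
    by (simp only: inv_com)
qed

lemma com_in_tree_increment_swap_left:
  assumes "x \<in> tree_increment s" "y \<in> tree_subgroup t"
  shows "com y x \<in> tree_increment (Node s t)"
proof -
  have "x \<in> carrier G" "y \<in> carrier G"
    using assms tree_subgroup_closed tree_increment_closed by auto
  then show ?thesis
    using subgroup.m_inv_closed[OF normal_imp_subgroup[OF tree_increment_normal] com_in_tree_increment(1)[OF assms]]
    by (simp only: inv_com)
qed

lemma tree_increment_subset: "tree_increment t \<subseteq> tree_subgroup t"
proof (induction t)
  case (Leaf i)
  show ?case using derived_term_antimono[of i "Suc i"] by simp
next
  case (Node s t)
  then show ?case
    using tree_subgroup_normal[of "Node s t", THEN normal_imp_subgroup]
    unfolding tree_increment.simps
    by (intro generate_subgroup_incl) (auto intro!: com_in_com_subgroup)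
qed

text \<open>A normal subgroup absorbs commutators with its elements. At the deepest leaf this puts
  the whole iterated commutator inside the deepest term.\<close>

lemma tree_subgroup_subset_derived_term: "i \<in> leaves t \<Longrightarrow> tree_subgroup t \<subseteq> derived_term i"
proof (induction t)
  case (Node s t)
  then have s: "i \<in> leaves s \<Longrightarrow> tree_subgroup s \<subseteq> derived_term i"
    and t: "i \<in> leaves t \<Longrightarrow> tree_subgroup t \<subseteq> derived_term i" by auto
  have "com x y \<in> derived_term i" if "x \<in> tree_subgroup s" "y \<in> tree_subgroup t" for x y
    using that Node.prems s t tree_subgroup_closed[of s] tree_subgroup_closed[of t]
    by (intro com_in_normal[OF derived_term_normal]) auto
  then show ?case
    unfolding tree_subgroup.simps
    by (rule com_subgroup_minimal[OF derived_term_subgroup])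
qed simp

lemma tree_values_subset_tree_subgroup: "tree_values G derived_term t \<subseteq> tree_subgroup t"
  by (induction t) (auto intro!: com_in_com_subgroup)

text \<open>Ensures that a nontrivial iterated commutator subgroup yields a nontrivial
  value.\<close>

lemma tree_subgroup_subset_generate: "tree_subgroup t \<subseteq> generate G (tree_values G derived_term t)"
proof (induction t)
  case (Leaf i)
  show ?case by (auto intro: generate.incl)
next
  case (Node s t)
  let ?Q = "generate G (tree_values G derived_term (Node s t))"
  note closed = tree_values_closed[of derived_term, OF derived_term_closed]
  have Q: "?Q \<lhd> G"
    using closed tree_values_conj[of derived_term, OF derived_term_normal] by (rule normal_generate)
  have "com x y \<in> ?Q" if "x \<in> tree_subgroup s" "y \<in> tree_subgroup t" for x y
  proof (rule com_generate[OF Q closed closed])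
    show "x \<in> generate G (tree_values G derived_term s)" "y \<in> generate G (tree_values G derived_term t)"
      using that Node by blast+
  qed (auto intro: generate.incl)
  then show ?case
    unfolding tree_subgroup.simps by (rule com_subgroup_minimal[OF normal_imp_subgroup[OF Q]])
qed

text \<open>Hence \<open>tree_increment t\<close> is trivial once every single increment has a
  trivial subgroup; this is how extremality of the labels is exploited.\<close>

lemma tree_increment_subset_generate:
  "tree_increment t \<subseteq> generate G (\<Union>t'\<in>increments t. tree_subgroup t')"
proof (induction t)
  case (Leaf i)
  then show ?case by (auto intro: generate.incl)
next
  case (Node s t)
  let ?U = "\<lambda>t. \<Union>t'\<in>increments t. tree_subgroup t'"
  let ?Q = "generate G (?U (Node s t))"
  have U: "?U u \<subseteq> carrier G" for u
    using tree_subgroup_closed by blast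
  have Q: "?Q \<lhd> G"
  proof (rule normal_generate[OF U])
    fix x g assume "x \<in> ?U (Node s t)" and g: "g \<in> carrier G"
    then obtain t' where t': "t' \<in> increments (Node s t)" "x \<in> tree_subgroup t'" by blast
    then have "inv g \<otimes> x \<otimes> g \<in> tree_subgroup t'"
      using normal.inv_op_closed1[OF tree_subgroup_normal g] by blast
    with t' show "inv g \<otimes> x \<otimes> g \<in> ?U (Node s t)" by blast
  qed
  have "com x y \<in> ?Q" if "x \<in> tree_increment s" "y \<in> tree_subgroup t" for x y
  proof (rule com_generate[OF Q U tree_subgroup_closed])
    fix x y assume "x \<in> ?U s" "y \<in> tree_subgroup t"
    then obtain s' where s': "s' \<in> increments s" "x \<in> tree_subgroup s'" by blast
    then have "com x y \<in> tree_subgroup (Node s' t)"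
      using \<open>y \<in> _\<close> by (simp add: com_in_com_subgroup)
    then show "com x y \<in> ?Q"
      using s' by (intro generate.incl UN_I[of "Node s' t"]) auto
  qed (use that Node in \<open>auto intro: generate.incl\<close>)
  moreover have "com x y \<in> ?Q" if "x \<in> tree_subgroup s" "y \<in> tree_increment t" for x y
  proof (rule com_generate[OF Q tree_subgroup_closed U])
    fix x y assume "y \<in> ?U t" "x \<in> tree_subgroup s"
    then obtain t' where t': "t' \<in> increments t" "y \<in> tree_subgroup t'" by blast
    then have "com x y \<in> tree_subgroup (Node s t')"
      using \<open>x \<in> _\<close> by (simp add: com_in_com_subgroup)
    then show "com x y \<in> ?Q"
      using t' by (intro generate.incl UN_I[of "Node s t'"]) auto
  qed (use that Node in \<open>auto intro: generate.incl\<close>)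
  ultimately show ?case
    unfolding tree_increment.simps
    by (intro generate_subgroup_incl[OF _ normal_imp_subgroup[OF Q]]) blast
qed

text \<open>Conjugation by \<open>g\<close> changes \<open>[a, c]\<close> into \<open>[a [a, g], c [c, g]]\<close>, which is expanded.\<close>

lemma tree_subgroup_centralized:
  assumes "\<And>j. j \<in> leaves t \<Longrightarrow> j \<le> i" and g: "g \<in> derived_term i" and x: "x \<in> tree_subgroup t"
  shows "com x g \<in> tree_increment t"
  using assms(1) x
proof (induction t arbitrary: x)
  case (Leaf j)
  then have "g \<in> derived_term j"
    using g derived_term_antimono[of j i] by auto
  with Leaf show ?case
    unfolding tree_increment.simps derived_term_Suc by (simp add: com_in_com_subgroup)
next
  case (Node s t)
  let ?Q = "tree_increment (Node s t)"
  note Q = tree_increment_normal[of "Node s t"]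
  interpret Q: normal ?Q G by (rule Q)
  have gc: "g \<in> carrier G"
    using g derived_term_closed by blast
  note sub = tree_subgroup_closed[THEN subsetD] tree_increment_closed[THEN subsetD]
  have *: "com (com a c) g \<in> ?Q" if a: "a \<in> tree_subgroup s" and c: "c \<in> tree_subgroup t" for a c
  proof -
    define k l u y p where "k = com a g" and "l = com c g" and "u = com a c" and "y = c \<otimes> l"
      and "p = com (com a y) k"
    have k: "k \<in> tree_increment s" and l: "l \<in> tree_increment t"
      using Node a c by (auto simp: k_def l_def)
    have cl: "a \<in> carrier G" "c \<in> carrier G" "k \<in> carrier G" "l \<in> carrier G" "u \<in> carrier G" "y \<in> carrier G"
      "p \<in> carrier G"
      using a c gc by (auto simp: sub k_def l_def u_def y_def p_def)
    have y: "y \<in> tree_subgroup t"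
      using c l tree_increment_subset[of t] subgroup.m_closed[OF normal_imp_subgroup[OF tree_subgroup_normal]]
      by (auto simp: y_def)
    \<comment> \<open>Normality places \<open>u\<close> and \<open>com a y\<close> on the side where
      they are needed, so that each error factor in \<open>r\<close> pairs an element of one child's
      increment with the other child's subgroup.\<close>
    have us: "u \<in> tree_subgroup s"
      unfolding u_def using a by (intro com_in_normal[OF tree_subgroup_normal cl(1,2)] disjI1)
    have ay: "com a y \<in> tree_subgroup t"
      using y by (intro com_in_normal[OF tree_subgroup_normal cl(1,6)] disjI2)
    have r: "com k y \<in> ?Q" "p \<in> ?Q" "com a l \<in> ?Q" "com u l \<in> ?Q"
      unfolding p_def by (fact com_in_tree_increment(1)[OF k y] com_in_tree_increment_swap_left[OF k ay]
          com_in_tree_increment(2)[OF a l] com_in_tree_increment(2)[OF us l])+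
    have "com (com a c) g = inv u \<otimes> (inv g \<otimes> com a c \<otimes> g)"
      unfolding u_def[symmetric] commutator_def[of G u] using cl gc by (simp only: m_assoc inv_closed m_closed)
    also have "inv g \<otimes> com a c \<otimes> g = com (a \<otimes> k) y"
      unfolding com_conj[OF cl(1,2) gc] conj_eq_mult_com[OF cl(1) gc] conj_eq_mult_com[OF cl(2) gc]
      by (simp only: k_def l_def y_def)
    also have "\<dots> = com a y \<otimes> (p \<otimes> com k y)"
      using cl by (simp add: com_mult_left p_def)
    also have "com a y = com a l \<otimes> (u \<otimes> com u l)"
      using cl by (simp add: com_mult_right y_def u_def)
    finally have "com (com a c) g = (inv u \<otimes> com a l \<otimes> u) \<otimes> (com u l \<otimes> (p \<otimes> com k y))"
      using cl by (simp add: m_assoc)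
    then show ?thesis
      using r cl Q.inv_op_closed1[of u "com a l"] by (simp only: Q.m_closed)
  qed
  show ?case
  proof (rule com_generate_left[OF Q _ gc])
    fix z assume "z \<in> {com x y |x y. x \<in> tree_subgroup s \<and> y \<in> tree_subgroup t}"
    then show "com z g \<in> ?Q" using * by blast
  next
    show "x \<in> generate G {com x y |x y. x \<in> tree_subgroup s \<and> y \<in> tree_subgroup t}"
      using Node.prems(2) by (simp add: com_subgroup_def)
  qed (auto simp: sub)
qed

text \<open>Expanding one factor \<open>a\<close> at a time, each step deviates from
  multiplicativity by some \<open>com (com (a [^] m) c) a\<close>, which lies in \<open>Q\<close>.
  The factor \<open>k\<close> accommodates the error arising in a subtree during the induction over
  trees.\<close>

lemma com_power_mod:
  assumes Q: "Q \<lhd> G" and cl: "a \<in> carrier G" "c \<in> carrier G" "k \<in> carrier G"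
    and a: "\<And>m::nat. com (com (a [^] m) c) a \<in> Q"
    and k: "com k c \<in> Q" "com (com (a [^] n) c) k \<in> Q"
  shows "\<exists>q\<in>Q. com (a [^] (n::nat) \<otimes> k) c = com a c [^] n \<otimes> q"
proof -
  interpret Q: normal Q G by (rule Q)
  define u where "u = com a c"
  have u: "u \<in> carrier G" using cl by (simp add: u_def)
  have "\<exists>q\<in>Q. com (a [^] n) c = u [^] n \<otimes> q"
  proof (induction n)
    case (Suc n)
    then obtain q where q: "q \<in> Q" "com (a [^] n) c = u [^] n \<otimes> q" by blast
    define r where "r = com (com (a [^] n) c) a"
    have r: "r \<in> Q" using a by (simp add: r_def)
    have "com (a [^] Suc n) c = (u [^] n \<otimes> q) \<otimes> (r \<otimes> u)"
      using cl by (simp add: com_mult_left q(2) r_def u_def)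
    also have "\<dots> = u [^] Suc n \<otimes> (inv u \<otimes> (q \<otimes> r) \<otimes> u)"
      using q(1) r u by (simp add: m_assoc)
    finally show ?case
      using Q.inv_op_closed1[OF u Q.m_closed[OF q(1) r]] by blast
  qed (use cl in \<open>auto intro!: bexI[of _ \<one>]\<close>)
  then obtain q where q: "q \<in> Q" "com (a [^] n) c = u [^] n \<otimes> q" by blast
  have "com (a [^] n \<otimes> k) c = u [^] n \<otimes> (q \<otimes> (com (com (a [^] n) c) k \<otimes> com k c))"
    using cl q u k by (simp add: com_mult_left m_assoc)
  then show ?thesis
    using q k unfolding u_def by (meson Q.m_closed)
qed

text \<open>The error factor \<open>k\<close> makes the induction work, as powers are values only
  modulo the increment. The recursion descends into a child containing the label \<open>i\<close>:
  its subgroup lies in \<open>derived_term i\<close> and therefore centralizes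
  \<open>tree_subgroup t\<close> modulo the increment.\<close>

lemma tree_values_power:
  assumes "\<And>j. j \<in> leaves t \<Longrightarrow> j \<le> i" "i \<in> leaves t" and x: "x \<in> tree_values G derived_term t"
  shows "\<exists>k\<in>tree_increment t. x [^] (n::nat) \<otimes> k \<in> tree_values G derived_term t"
  using assms
proof (induction t arbitrary: x)
  case (Leaf j)
  then have "x [^] n \<in> derived_term j"
    using subgroup_nat_pow_closed[OF derived_term_subgroup] by simp
  moreover have "\<one> \<in> derived_term (Suc j)"
    by (rule subgroup.one_closed[OF derived_term_subgroup])
  moreover have "x [^] n \<otimes> \<one> = x [^] n"
    using Leaf.prems derived_term_closed[THEN subsetD] by simp
  ultimately show ?case by force
next
  case (Node s t)
  let ?Q = "tree_increment (Node s t)"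
  interpret Q: normal ?Q G by (rule tree_increment_normal)
  note sub = tree_subgroup_closed[THEN subsetD] tree_increment_closed[THEN subsetD]
  note centralized = tree_subgroup_centralized[of "Node s t" i, OF Node.prems(1)]
  obtain a c where ac: "x = com a c" "a \<in> tree_values G derived_term s" "c \<in> tree_values G derived_term t"
    using Node.prems by auto
  then have as: "a \<in> tree_subgroup s" and ct: "c \<in> tree_subgroup t"
    using tree_values_subset_tree_subgroup by auto
  then have cl: "a \<in> carrier G" "c \<in> carrier G" by (auto simp: sub)
  have pow: "y [^] (m::nat) \<in> tree_subgroup u" if "y \<in> tree_subgroup u" for y u m
    using that by (rule subgroup_nat_pow_closed[OF normal_imp_subgroup[OF tree_subgroup_normal]])
  from Node.prems(2) consider "i \<in> leaves s" | "i \<in> leaves t" by auto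
  then show ?case
  proof cases
    case 1
    with Node.IH(1)[of a] Node.prems ac obtain k
      where k: "k \<in> tree_increment s" "a [^] n \<otimes> k \<in> tree_values G derived_term s" by auto
    have ai: "a \<in> derived_term i"
      using as tree_subgroup_subset_derived_term[OF 1] by auto
    have "com (a [^] m) c \<in> tree_subgroup (Node s t)" for m :: nat
      using pow[OF as] ct by (simp add: com_in_com_subgroup)
    then have "com (com (a [^] m) c) a \<in> ?Q" for m :: nat
      using ai by (intro centralized)
    moreover have "com (a [^] n) c \<in> tree_subgroup t"
      using ct cl by (intro com_in_normal[OF tree_subgroup_normal _ _ disjI2]) simp_all
    then have "com (com (a [^] n) c) k \<in> ?Q"
      using k by (intro com_in_tree_increment_swap_left)
    moreover have "com k c \<in> ?Q"
      using k ct by (intro com_in_tree_increment)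
    ultimately obtain q where "q \<in> ?Q" "com (a [^] n \<otimes> k) c = x [^] n \<otimes> q"
      using com_power_mod[OF tree_increment_normal cl, of k "Node s t" n] k ac by (auto simp: sub)
    moreover have "com (a [^] n \<otimes> k) c \<in> tree_values G derived_term (Node s t)"
      using k ac by auto
    ultimately show ?thesis by metis
  next
    \<comment> \<open>The power formula concerns the left argument, so it is applied to
      \<open>com c a\<close>, the inverse of \<open>x\<close>, and the result is inverted.\<close>
    case 2
    with Node.IH(2)[of c] Node.prems ac obtain k
      where k: "k \<in> tree_increment t" "c [^] n \<otimes> k \<in> tree_values G derived_term t" by auto
    have kc: "k \<in> carrier G" using k by (auto simp: sub)
    have ci: "c \<in> derived_term i"
      using ct tree_subgroup_subset_derived_term[OF 2] by auto
    have "inv (com a (c [^] m)) \<in> tree_subgroup (Node s t)" for m :: nat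
      using pow[OF ct] as
      by (intro subgroup.m_inv_closed[OF normal_imp_subgroup[OF tree_subgroup_normal]])
        (simp add: com_in_com_subgroup)
    then have "com (c [^] m) a \<in> tree_subgroup (Node s t)" for m :: nat
      using cl by (simp only: inv_com nat_pow_closed)
    then have "com (com (c [^] m) a) c \<in> ?Q" for m :: nat
      using ci by (intro centralized)
    moreover have "com (c [^] n) a \<in> tree_subgroup s"
      using as cl by (intro com_in_normal[OF tree_subgroup_normal _ _ disjI2]) simp_all
    then have "com (com (c [^] n) a) k \<in> ?Q"
      using k by (intro com_in_tree_increment)
    moreover have "com k a \<in> ?Q"
      using k as by (intro com_in_tree_increment_swap_right)
    ultimately obtain q where q: "q \<in> ?Q" "com (c [^] n \<otimes> k) a = com c a [^] n \<otimes> q"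
      using com_power_mod[OF tree_increment_normal cl(2,1), of k "Node s t" n] kc by blast
    have qc: "q \<in> carrier G" using q(1) by (rule Q.mem_carrier)
    have x: "x \<in> carrier G" "inv x = com c a"
      using ac cl by (auto simp: inv_com)
    have "com a (c [^] n \<otimes> k) = inv (inv x [^] n \<otimes> q)"
      using q cl kc x by (simp add: inv_com flip: q(2))
    also have "\<dots> = x [^] n \<otimes> (inv (x [^] n) \<otimes> inv q \<otimes> x [^] n)"
      using qc x(1) by (simp add: inv_mult_group nat_pow_inv m_assoc)
    finally have "com a (c [^] n \<otimes> k) = x [^] n \<otimes> (inv (x [^] n) \<otimes> inv q \<otimes> x [^] n)" .
    moreover have "inv (x [^] n) \<otimes> inv q \<otimes> x [^] n \<in> ?Q"
      by (intro Q.inv_op_closed1 Q.m_inv_closed q(1) nat_pow_closed x(1))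
    moreover have "com a (c [^] n \<otimes> k) \<in> tree_values G derived_term (Node s t)"
      using k ac by auto
    ultimately show ?thesis by metis
  qed
qed


section \<open>Extremal labellings and commuting conjugates\<close>

lemma exists_power_closed_value:
  assumes n: "vals (full n) \<subseteq> {\<one>}" and t: "\<not> vals t \<subseteq> {\<one>}"
  obtains x where "x \<in> vals t" "x \<noteq> \<one>" "\<And>k::nat. x [^] k \<in> vals t"
    "\<And>g. g \<in> carrier G \<Longrightarrow> com x (inv g \<otimes> x \<otimes> g) = \<one>"
proof -
  \<comment> \<open>Only the labels vary, not the shape, so a relabelled tree still has its values
    among those of \<open>t\<close>.\<close>
  define P where "P u \<longleftrightarrow> unlabelled u = unlabelled t \<and> \<not> tree_subgroup u \<subseteq> {\<one>}" for u
  have "generate G (vals (full n)) \<subseteq> {\<one>}"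
    using n triv_subgroup by (intro generate_subgroup_incl)
  then have dn: "derived_term n \<subseteq> {\<one>}"
    using derived_term_subset_generate_full by blast
  have "tree_values G derived_term (unlabelled t) = vals (unlabelled t)"
    using leaves_unlabelled[of t] by (intro equalityI tree_values_mono) auto
  then have "vals t \<subseteq> tree_subgroup (unlabelled t)"
    using tree_values_subset_tree_subgroup[of "unlabelled t"] by (simp add: tree_values_unlabelled)
  with t have "P (unlabelled t)"
    by (auto simp: P_def unlabelled_unlabelled)
  \<comment> \<open>No leaf carries a label above \<open>n\<close>: the iterated commutator would
    lie in a trivial derived term.\<close>
  moreover have "label_sum u \<le> n * leaf_count t" if "P u" for u
  proof -
    have "i \<le> n" if i: "i \<in> leaves u" for i
    proof (rule ccontr)
      assume "\<not> i \<le> n"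
      then have "derived_term i \<subseteq> derived_term n" by (intro derived_term_antimono) simp
      with tree_subgroup_subset_derived_term[OF i] dn \<open>P u\<close> show False by (auto simp: P_def)
    qed
    then have "label_sum u \<le> n * leaf_count u" by (rule label_sum_le)
    also have "leaf_count u = leaf_count t"
      using that by (metis P_def leaf_count_unlabelled)
    finally show ?thesis .
  qed
  ultimately obtain u where u: "P u" "\<And>v. P v \<Longrightarrow> label_sum v \<le> label_sum u"
    using ex_has_greatest_nat[of P "unlabelled t" label_sum "Suc (n * leaf_count t)"]
    by (auto simp: less_Suc_eq_le)
  \<comment> \<open>An increment keeps the shape and raises the label sum by one, so maximality of
    \<open>u\<close> forces triviality.\<close>
  have "tree_subgroup v \<subseteq> {\<one>}" if "v \<in> increments u" for v
    using u(2)[of v] that increments_label_sum[OF that] increments_unlabelled[OF that] u(1)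
    by (auto simp: P_def)
  then have "generate G (\<Union>v\<in>increments u. tree_subgroup v) \<subseteq> {\<one>}"
    using triv_subgroup by (intro generate_subgroup_incl) blast
  then have trivial: "tree_increment u \<subseteq> {\<one>}"
    using tree_increment_subset_generate by blast
  have "\<not> tree_values G derived_term u \<subseteq> {\<one>}"
  proof
    assume "tree_values G derived_term u \<subseteq> {\<one>}"
    then have "generate G (tree_values G derived_term u) \<subseteq> {\<one>}"
      using triv_subgroup by (intro generate_subgroup_incl)
    with u(1) tree_subgroup_subset_generate show False by (auto simp: P_def)
  qed
  then obtain x where x: "x \<in> tree_values G derived_term u" "x \<noteq> \<one>" by blast
  have "tree_values G derived_term u \<subseteq> vals u"
    using derived_term_closed by (rule tree_values_mono)
  also have "vals u = vals t"
    using u(1) by (metis P_def tree_values_unlabelled)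
  finally have vals: "tree_values G derived_term u \<subseteq> vals t" .
  \<comment> \<open>The deepest term in use. It contains \<open>tree_subgroup u\<close>, and
    centralizes it because \<open>tree_increment u\<close> is trivial.\<close>
  define i where "i = Max (leaves u)"
  have i: "i \<in> leaves u" "\<And>j. j \<in> leaves u \<Longrightarrow> j \<le> i"
    using leaves_finite[of u] by (auto simp: i_def)
  show thesis
  proof
    show "x \<in> vals t" "x \<noteq> \<one>" using x vals by auto
    have xc: "x \<in> carrier G"
      using x vals vals_closed by blast
    show "x [^] k \<in> vals t" for k :: nat
    proof -
      obtain q where "q \<in> tree_increment u" "x [^] k \<otimes> q \<in> tree_values G derived_term u"
        using tree_values_power[OF i(2) i(1) x(1)] by blast
      with trivial xc have "x [^] k \<in> tree_values G derived_term u" by auto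
      with vals show ?thesis by blast
    qed
    fix g assume g: "g \<in> carrier G"
    have xu: "x \<in> tree_subgroup u"
      using x tree_values_subset_tree_subgroup by blast
    then have "inv g \<otimes> x \<otimes> g \<in> tree_subgroup u"
      using normal.inv_op_closed1[OF tree_subgroup_normal g] by blast
    then have "inv g \<otimes> x \<otimes> g \<in> derived_term i"
      using tree_subgroup_subset_derived_term[OF i(1)] by blast
    then show "com x (inv g \<otimes> x \<otimes> g) = \<one>"
      using tree_subgroup_centralized[OF i(2) _ xu] trivial by blast
  qed
qed


text \<open>The whole conjugacy class of the value is taken, since the subgroup it generates is
  normal and can be factored out.\<close>

lemma exists_commuting_power_closed_values:
  assumes "vals (full n) \<subseteq> {\<one>}" and "\<not> vals t \<subseteq> {\<one>}"
  obtains X where "X \<subseteq> vals t" "\<not> X \<subseteq> {\<one>}"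
    "\<And>x g. x \<in> X \<Longrightarrow> g \<in> carrier G \<Longrightarrow> inv g \<otimes> x \<otimes> g \<in> X"
    "\<And>x y. x \<in> X \<Longrightarrow> y \<in> X \<Longrightarrow> com x y = \<one>"
    "\<And>x (k::nat). x \<in> X \<Longrightarrow> x [^] k \<in> vals t"
proof -
  obtain x where x: "x \<in> vals t" "x \<noteq> \<one>" "\<And>k::nat. x [^] k \<in> vals t"
    "\<And>g. g \<in> carrier G \<Longrightarrow> com x (inv g \<otimes> x \<otimes> g) = \<one>"
    using exists_power_closed_value[OF assms] by blast
  have xc: "x \<in> carrier G"
    using x(1) vals_closed by blast
  define X where "X = {inv g \<otimes> x \<otimes> g | g. g \<in> carrier G}"
  show thesis
  proof
    show "X \<subseteq> vals t"
      using vals_conj[OF x(1)] by (auto simp: X_def)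
    have "x \<in> X"
      unfolding X_def using xc by (intro CollectI exI[of _ \<one>]) simp
    with x(2) show "\<not> X \<subseteq> {\<one>}" by blast
  next
    fix y g assume "y \<in> X" and g: "g \<in> carrier G"
    then obtain h where h: "h \<in> carrier G" "y = inv h \<otimes> x \<otimes> h" by (auto simp: X_def)
    then have "inv g \<otimes> y \<otimes> g = inv (h \<otimes> g) \<otimes> x \<otimes> (h \<otimes> g)"
      using xc g by (simp add: inv_mult_group m_assoc)
    with g h show "inv g \<otimes> y \<otimes> g \<in> X" unfolding X_def by blast
  next
    fix y z assume "y \<in> X" "z \<in> X"
    then obtain g h where gh: "g \<in> carrier G" "y = inv g \<otimes> x \<otimes> g" "h \<in> carrier G" "z = inv h \<otimes> x \<otimes> h"
      by (auto simp: X_def)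
    \<comment> \<open>Conjugating by the inverse of \<open>g\<close> reduces commutation of two
      conjugates of \<open>x\<close> to that of \<open>x\<close> with the single conjugate
      \<open>w\<close>.\<close>
    define w where "w = inv (h \<otimes> inv g) \<otimes> x \<otimes> (h \<otimes> inv g)"
    have w: "w \<in> carrier G" "com x w = \<one>"
      using gh xc x(4)[of "h \<otimes> inv g"] by (auto simp: w_def)
    have "z = inv g \<otimes> w \<otimes> g"
      using gh xc by (simp add: w_def inv_mult_group m_assoc)
    then have "com y z = inv g \<otimes> com x w \<otimes> g"
      unfolding gh(2) com_conj[OF xc w(1) gh(1)] by (rule arg_cong)
    then show "com y z = \<one>" using w gh by simp
  next
    fix y and k :: nat assume "y \<in> X"
    then obtain g where g: "g \<in> carrier G" "y = inv g \<otimes> x \<otimes> g" by (auto simp: X_def)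
    have "y [^] k = inv g \<otimes> x [^] k \<otimes> g"
      using g xc by (induction k) (simp_all add: m_assoc)
    then show "y [^] k \<in> vals t"
      using vals_conj[OF x(3) g(1)] by simp
  qed
qed

section \<open>Subgroups generated by commuting values\<close>

lemma pow_diff_eq_one:
  assumes "x \<in> carrier G" "x [^] (i::nat) = x [^] j" "i < j"
  shows "x [^] (j - i) = \<one>"
proof -
  have "x [^] i \<otimes> x [^] (j - i) = x [^] i \<otimes> \<one>"
    unfolding nat_pow_mult[OF assms(1)] using assms by simp
  then show ?thesis using assms(1) by (metis Units_eq Units_l_cancel nat_pow_closed one_closed)
qed

text \<open>If \<open>k\<close> is the order of \<open>y\<close> modulo \<open>C\<close>, then adjoining \<open>y\<close> multiplies the cardinality by \<open>k \<le> 2\<^sup>k\<^sup>-\<^sup>1\<close>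
  and adds the \<open>k - 1\<close> new values \<open>y, \<dots>, y\<^sup>k\<^sup>-\<^sup>1\<close>.\<close>

lemma card_adjoin_commuting:
  assumes C: "subgroup C G" "finite C" and y: "y \<in> carrier G" "\<And>c. c \<in> C \<Longrightarrow> c \<otimes> y = y \<otimes> c"
    and V: "finite V" "\<And>k::nat. y [^] k \<in> V"
    and bound: "2 * card C \<le> 2 ^ card (V \<inter> C)"
  defines "C' \<equiv> generate G (insert y C)"
  shows "finite C' \<and> 2 * card C' \<le> 2 ^ card (V \<inter> C')"
proof -
  interpret C: subgroup C G by fact
  \<comment> \<open>All powers of \<open>y\<close> lie in the finite set \<open>V\<close>, so two of
    them coincide and some positive power is trivial.\<close>
  have "\<not> inj (\<lambda>k::nat. y [^] k)"
    using V finite_subset[of "range (\<lambda>k::nat. y [^] k)" V] by (auto dest: finite_imageD)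
  then obtain i j :: nat where "y [^] i = y [^] j" "i < j"
    unfolding inj_def by (metis linorder_neqE_nat)
  then have "\<exists>k>0. y [^] (k::nat) \<in> C"
    using pow_diff_eq_one[OF y(1)] by (intro exI[of _ "j - i"]) auto
  define k :: nat where "k = (LEAST k. 0 < k \<and> y [^] k \<in> C)"
  have k: "0 < k" "y [^] k \<in> C" and least: "\<And>m. 0 < m \<Longrightarrow> m < k \<Longrightarrow> y [^] m \<notin> C"
    using LeastI_ex[OF \<open>\<exists>k>0. _ k\<close>] not_less_Least[of _ "\<lambda>k. 0 < k \<and> y [^] k \<in> C"]
    by (auto simp: k_def)
  have comm: "c \<otimes> y [^] m = y [^] m \<otimes> c" if "c \<in> C" for c and m :: nat
  proof (induction m)
    case (Suc m)
    have "c \<otimes> y [^] Suc m = (c \<otimes> y [^] m) \<otimes> y"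
      using that y by (simp add: m_assoc)
    also have "\<dots> = y [^] m \<otimes> (c \<otimes> y)"
      unfolding Suc using that y(1) by (simp add: m_assoc)
    finally show ?case using that y by (simp add: m_assoc)
  qed (use that in simp)
  \<comment> \<open>Reducing exponents modulo \<open>k\<close> at the cost of a factor in
    \<open>C\<close> shows that these products exhaust \<open>C'\<close>.\<close>
  define S where "S = (\<lambda>(c, m). c \<otimes> y [^] (m::nat)) ` (C \<times> {..<k})"
  have S: "c \<otimes> y [^] m \<in> S" if c: "c \<in> C" for c and m :: nat
  proof -
    have "y [^] m = (y [^] k) [^] (m div k) \<otimes> y [^] (m mod k)"
      using y(1) by (simp add: nat_pow_pow nat_pow_mult)
    then have "c \<otimes> y [^] m = (c \<otimes> (y [^] k) [^] (m div k)) \<otimes> y [^] (m mod k)"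
      using c y(1) by (simp add: m_assoc)
    moreover have "c \<otimes> (y [^] k) [^] (m div k) \<in> C"
      using c k(2) subgroup_nat_pow_closed[OF C(1)] by simp
    ultimately show ?thesis
      unfolding S_def using k(1)
      by (intro image_eqI[of _ _ "(c \<otimes> (y [^] k) [^] (m div k), m mod k)"]) auto
  qed
  have "z \<in> S" if "z \<in> C'" for z
    using that unfolding C'_def
  proof induction
    case one
    then show ?case using S[of \<one> 0] by simp
  next
    case (incl h)
    then show ?case using S[of \<one> 1] S[of h 0] y by auto
  next
    case (inv h)
    show ?case
    proof (cases "h \<in> C")
      case True
      then show ?thesis using S[of "inv h" 0] by simp
    next
      case False
      with inv have "h = y" by simp
      have "y [^] (k - 1) = y [^] k \<otimes> inv y"
        using k(1) y(1) by (cases k) (auto simp: m_assoc)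
      then have "inv y = inv (y [^] k) \<otimes> y [^] (k - 1)"
        using y(1) by simp
      then show ?thesis using S[of "inv (y [^] k)" "k - 1"] k(2) \<open>h = y\<close> by simp
    qed
  next
    case (eng u v)
    then obtain c d i j where uv: "c \<in> C" "d \<in> C" "u = c \<otimes> y [^] (i::nat)" "v = d \<otimes> y [^] (j::nat)"
      by (auto simp: S_def)
    have "u \<otimes> v = c \<otimes> (y [^] i \<otimes> d) \<otimes> y [^] j"
      using uv y(1) by (simp add: m_assoc)
    also have "\<dots> = (c \<otimes> d) \<otimes> y [^] (i + j)"
      using uv(1,2) y(1) by (simp add: comm[symmetric] m_assoc nat_pow_mult)
    finally show ?case using S uv by simp
  qed
  then have sub: "C' \<subseteq> S" by blast
  have finS: "finite S" and cardS: "card S \<le> card C * k"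
    using C(2) card_image_le[of "C \<times> {..<k}" "\<lambda>(c, m). c \<otimes> y [^] (m::nat)"]
    by (auto simp: S_def card_cartesian_product)
  have C': "subgroup C' G"
    unfolding C'_def using y(1) C.subset by (intro generate_is_subgroup) auto
  have yC': "y \<in> C'" and CC': "C \<subseteq> C'"
    unfolding C'_def by (auto intro: generate.incl)
  \<comment> \<open>Exponent 0 is left out because \<one> already lies in \<open>C\<close>;
    minimality of \<open>k\<close> keeps the other powers distinct and outside
    \<open>C\<close>.\<close>
  let ?Y = "(\<lambda>m::nat. y [^] m) ` {1..<k}"
  have "inj_on (\<lambda>m::nat. y [^] m) {1..<k}"
  proof (rule linorder_inj_onI')
    fix i j assume ij: "i \<in> {1..<k}" "j \<in> {1..<k}" "i < j"
    then show "y [^] i \<noteq> y [^] j"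
      using pow_diff_eq_one[OF y(1), of i j] least[of "j - i"] less_imp_diff_less[of j k i] by auto
  qed
  then have cardY: "card ?Y = k - 1" by (simp add: card_image)
  have "card (V \<inter> C) + (k - 1) = card ((V \<inter> C) \<union> ?Y)"
    unfolding cardY[symmetric] using V(1) least by (intro card_Un_disjoint[symmetric]) auto
  also have "\<dots> \<le> card (V \<inter> C')"
    using V yC' CC' subgroup_nat_pow_closed[OF C'] by (intro card_mono) auto
  finally have new: "card (V \<inter> C) + (k - 1) \<le> card (V \<inter> C')" .
  have "k \<le> 2 ^ (k - 1)"
    using less_exp[of "k - 1"] k(1) by linarith
  have "2 * card C' \<le> 2 * card C * k"
    using card_mono[OF finS sub] cardS by simp
  also have "\<dots> \<le> 2 ^ card (V \<inter> C) * 2 ^ (k - 1)"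
    using bound \<open>k \<le> _\<close> by (rule mult_mono) auto
  also have "\<dots> \<le> 2 ^ card (V \<inter> C')"
    unfolding power_add[symmetric] using new by (rule power_increasing) simp
  finally show ?thesis using finite_subset[OF sub finS] by blast
qed

text \<open>The generators are adjoined one at a time. The factor 2 on the left replaces a
  subtraction in the exponent; for the trivial group both sides equal 2.\<close>

lemma card_generate_commuting:
  assumes "finite X" "X \<subseteq> carrier G" "\<And>x y. x \<in> X \<Longrightarrow> y \<in> X \<Longrightarrow> com x y = \<one>"
    and V: "finite V" "\<one> \<in> V" "\<And>x (k::nat). x \<in> X \<Longrightarrow> x [^] k \<in> V"
  shows "finite (generate G X) \<and> 2 * card (generate G X) \<le> 2 ^ card (V \<inter> generate G X)"
  using assms(1-3) V(3)
proof (induction X)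
  case empty
  have "V \<inter> {\<one>} = {\<one>}" using V by auto
  then show ?case by (simp add: generate_empty)
next
  case (insert y X)
  let ?C = "generate G X"
  have X: "X \<subseteq> carrier G" and y: "y \<in> carrier G" using insert.prems by auto
  have "com c y = \<one>" if "c \<in> ?C" for c
    using com_generate_left[OF one_is_normal X y _ that] insert.prems by auto
  then have "c \<otimes> y = y \<otimes> c" if "c \<in> ?C" for c
    using that generate_in_carrier[OF X that] y com_eq_one_iff by blast
  moreover have "finite ?C \<and> 2 * card ?C \<le> 2 ^ card (V \<inter> ?C)"
    using insert.prems by (intro insert.IH) auto
  ultimately have "finite (generate G (insert y ?C)) \<and>
      2 * card (generate G (insert y ?C)) \<le> 2 ^ card (V \<inter> generate G (insert y ?C))"
    using insert.prems y V generate_is_subgroup[OF X] by (intro card_adjoin_commuting) auto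
  moreover have "generate G (insert y ?C) = generate G (insert y X)"
  proof
    have "insert y ?C \<subseteq> generate G (insert y X)"
      using mono_generate[of X "insert y X"] by (auto intro: generate.incl)
    then show "generate G (insert y ?C) \<subseteq> generate G (insert y X)"
      using insert.prems by (intro generate_subgroup_incl generate_is_subgroup)
    show "generate G (insert y X) \<subseteq> generate G (insert y ?C)"
      by (intro mono_generate) (auto intro: generate.incl)
  qed
  ultimately show ?case by simp
qed

end

section \<open>Enlarging a finite normal subgroup through its quotient\<close>

lemma (in group_hom) hom_commutator:
  "x \<in> carrier G \<Longrightarrow> y \<in> carrier G \<Longrightarrow> h (commutator G x y) = commutator H (h x) (h y)"
  by (simp add: commutator_def)

lemma (in group_hom) hom_tree_values:
  assumes "A \<subseteq> carrier G"
  shows "h ` tree_values G (\<lambda>_. A) t = tree_values H (\<lambda>_. h ` A) t"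
proof (induction t)
  case (Node s t)
  have "tree_values G (\<lambda>_. A) u \<subseteq> carrier G" for u
    using assms by (rule G.tree_values_closed)
  then have "h (commutator G x y) = commutator H (h x) (h y)"
    if "x \<in> tree_values G (\<lambda>_. A) s" "y \<in> tree_values G (\<lambda>_. A) t" for x y
    using that by (intro hom_commutator) blast+
  then have "h ` tree_values G (\<lambda>_. A) (Node s t) = {commutator H (h x) (h y) | x y.
      x \<in> tree_values G (\<lambda>_. A) s \<and> y \<in> tree_values G (\<lambda>_. A) t}"
    by (force simp: image_iff)
  also have "\<dots> = tree_values H (\<lambda>_. h ` A) (Node s t)"
    unfolding tree_values.simps Node[symmetric] by blast
  finally show ?case .
qed simp

context group
begin

text \<open>Commuting values found in the quotient by \<open>H\<close> generate a finite normal
  subgroup there, and \<open>N\<close> is its preimage. With V = \<open>vals t\<close>, the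
  inequality is |N| / |H| <= 2^(|V \<inter> N| - |V \<inter> H|), multiplied out so that repeated
  extensions telescope.\<close>

lemma extend_finite_normal:
  assumes H: "H \<lhd> G" "finite H" and fin: "finite (vals t)"
    and n: "vals (full n) \<subseteq> H" and t: "\<not> vals t \<subseteq> H"
  obtains N where "N \<lhd> G" "finite N" "H \<subseteq> N" "\<not> vals t \<inter> N \<subseteq> H"
    "card N * 2 ^ card (vals t \<inter> H) \<le> card H * 2 ^ card (vals t \<inter> N)"
proof -
  interpret H: normal H G by fact
  let ?Q = "G Mod H" and ?V = "vals t"
  define h where "h x = H #> x" for x
  interpret Q: group ?Q by (rule H.factorgroup_is_group)
  have "h \<in> hom G ?Q"
    unfolding h_def by (rule H.r_coset_hom_Mod)
  then interpret h: group_hom G ?Q h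
    by unfold_locales
  have oneQ: "\<one>\<^bsub>?Q\<^esub> = H" by (simp add: FactGroup_def)
  have carrierQ: "carrier ?Q = h ` carrier G"
    by (auto simp: FactGroup_def RCOSETS_def h_def)
  have h_vals: "h ` vals u = Q.vals u" for u
    using h.hom_tree_values[of "carrier G" u] by (simp add: carrierQ)
  have h_one: "h x = H \<longleftrightarrow> x \<in> H" if "x \<in> carrier G" for x
    unfolding h_def using that H.is_subgroup coset_join1 coset_join2 H.subset by metis
  have "Q.vals u \<subseteq> {\<one>\<^bsub>?Q\<^esub>} \<longleftrightarrow> vals u \<subseteq> H" for u
    unfolding h_vals[symmetric] oneQ image_subset_iff
    using h_one[OF subsetD[OF vals_closed]] by (simp add: subset_eq)
  then have "Q.vals (full n) \<subseteq> {\<one>\<^bsub>?Q\<^esub>}" "\<not> Q.vals t \<subseteq> {\<one>\<^bsub>?Q\<^esub>}"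
    using n t by simp_all
  then obtain X where X: "X \<subseteq> Q.vals t" "\<not> X \<subseteq> {\<one>\<^bsub>?Q\<^esub>}"
    "\<And>x g. x \<in> X \<Longrightarrow> g \<in> carrier ?Q \<Longrightarrow> inv\<^bsub>?Q\<^esub> g \<otimes>\<^bsub>?Q\<^esub> x \<otimes>\<^bsub>?Q\<^esub> g \<in> X"
    "\<And>x y. x \<in> X \<Longrightarrow> y \<in> X \<Longrightarrow> commutator ?Q x y = \<one>\<^bsub>?Q\<^esub>"
    "\<And>x (k::nat). x \<in> X \<Longrightarrow> x [^]\<^bsub>?Q\<^esub> k \<in> Q.vals t"
    by (rule Q.exists_commuting_power_closed_values) (rule that)
  have finQ: "finite (Q.vals t)"
    using fin unfolding h_vals[symmetric] by simp
  have Xc: "X \<subseteq> carrier ?Q"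
    using X(1) Q.vals_closed by blast
  define B where "B = generate ?Q X"
  have finB: "finite B" and cardB: "2 * card B \<le> 2 ^ card (Q.vals t \<inter> B)"
    using Q.card_generate_commuting[OF finite_subset[OF X(1) finQ] Xc X(4) finQ Q.one_in_vals X(5)]
    by (auto simp: B_def)
  have B: "B \<lhd> ?Q"
    unfolding B_def using Xc X(3) by (rule Q.normal_generate)
  interpret B: normal B ?Q by (rule B)
  define N where "N = {g \<in> carrier G. h g \<in> B}"
  have "subgroup N G"
  proof (rule subgroup.intro)
    show "x \<otimes> y \<in> N" if "x \<in> N" "y \<in> N" for x y
      using that B.m_closed[of "h x" "h y"] by (simp add: N_def del: mult_FactGroup flip: h.hom_mult)
    show "\<one> \<in> N"
      using B.one_closed h.hom_one unfolding N_def by simp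
    show "inv x \<in> N" if "x \<in> N" for x
      using that B.m_inv_closed[of "h x"] by (simp add: N_def)
  qed (auto simp: N_def)
  moreover have "x \<otimes> y \<otimes> inv x \<in> N" if "x \<in> carrier G" "y \<in> N" for x y
    using that B.inv_op_closed2[of "h x" "h y"] by (simp add: N_def del: mult_FactGroup)
  ultimately have N: "N \<lhd> G"
    unfolding normal_inv_iff by blast
  have HN: "H \<subseteq> N"
    using h_one[OF H.mem_carrier] B.one_closed unfolding oneQ N_def by auto
  have coset: "h g = c \<longleftrightarrow> g \<in> c" if "g \<in> carrier G" "c \<in> carrier ?Q" for g c
  proof -
    from that(2) obtain x where x: "x \<in> carrier G" "c = H #> x" by (auto simp: carrierQ h_def)
    show ?thesis
      unfolding h_def x(2) using repr_independence[OF _ x(1) H.is_subgroup, of g] rcos_self[OF that(1) H.is_subgroup]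
      by metis
  qed
  have BQ: "c \<in> carrier ?Q" "c \<in> rcosets H" "c \<subseteq> carrier G" if "c \<in> B" for c
  proof -
    show c: "c \<in> carrier ?Q" using that B.subset by blast
    then show "c \<in> rcosets H" by (simp add: FactGroup_def)
    then show "c \<subseteq> carrier G" using rcosets_part_G[OF H.is_subgroup] by blast
  qed
  \<comment> \<open>The elements of \<open>B\<close> are disjoint cosets of \<open>H\<close>, so
    this yields |N| = |B| |H|.\<close>
  have "N = \<Union>B"
  proof (intro equalityI subsetI)
    fix x assume "x \<in> N"
    then show "x \<in> \<Union>B" using coset[of x "h x"] by (auto simp: N_def)
  next
    fix x assume "x \<in> \<Union>B"
    then obtain c where c: "c \<in> B" "x \<in> c" by blast
    then have "x \<in> carrier G" "h x = c" using BQ[of c] coset[of x c] by auto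
    with c show "x \<in> N" by (simp add: N_def)
  qed
  have "card c = card H" if "c \<in> B" for c
    using card_rcosets_equal[OF BQ(2)[OF that] H.subset] by simp
  moreover have "pairwise disjnt B"
    using rcos_disjoint[OF H.is_subgroup] BQ(2) by (auto simp: pairwise_def disjnt_def)
  moreover have finc: "finite c" if "c \<in> B" for c
    using BQ(2)[OF that] H by (auto simp: RCOSETS_def r_coset_def)
  ultimately have cardN: "card N = card B * card H"
    unfolding \<open>N = \<Union>B\<close> by (subst card_Union_disjoint) auto
  have finN: "finite N"
    unfolding \<open>N = \<Union>B\<close> using finB finc by blast
  \<comment> \<open>Every nontrivial value in \<open>B\<close> lifts to a value in \<open>N\<close>
    outside \<open>H\<close>; these are the values newly used up.\<close>
  have "Q.vals t \<inter> B - {H} \<subseteq> h ` (?V \<inter> N - H)"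
  proof
    fix c assume c: "c \<in> Q.vals t \<inter> B - {H}"
    then obtain v where v: "v \<in> ?V" "c = h v" unfolding h_vals[symmetric] by blast
    with c show "c \<in> h ` (?V \<inter> N - H)"
      using vals_closed h_one[of v] by (auto simp: N_def)
  qed
  then have "card (Q.vals t \<inter> B - {H}) \<le> card (?V \<inter> N - H)"
    using fin by (intro surj_card_le) auto
  moreover have "?V \<inter> N = (?V \<inter> N - H) \<union> (?V \<inter> H)"
    using HN by blast
  then have "card (?V \<inter> N - H) + card (?V \<inter> H) = card (?V \<inter> N)"
    using fin card_Un_disjoint[of "?V \<inter> N - H" "?V \<inter> H"] by fastforce
  \<comment> \<open>The remaining value is the identity \<open>H\<close> of the quotient. This shift
    by one cancels the factor 2 in \<open>cardB\<close>.\<close>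
  moreover have "card (Q.vals t \<inter> B) = Suc (card (Q.vals t \<inter> B - {H}))"
    using finQ Q.one_in_vals B.one_closed unfolding oneQ by (intro card.remove) auto
  ultimately have "card (Q.vals t \<inter> B) + card (?V \<inter> H) \<le> Suc (card (?V \<inter> N))"
    by linarith
  then have "2 ^ card (Q.vals t \<inter> B) * 2 ^ card (?V \<inter> H) \<le> (2::nat) * 2 ^ card (?V \<inter> N)"
    unfolding power_add[symmetric] power_Suc[symmetric] by (rule power_increasing) simp
  then have "2 * card B * 2 ^ card (?V \<inter> H) \<le> 2 * 2 ^ card (?V \<inter> N)"
    using cardB by (meson le_trans mult_le_mono1)
  then have bound: "card N * 2 ^ card (?V \<inter> H) \<le> card H * 2 ^ card (?V \<inter> N)"
    using mult_left_mono[of "card B * 2 ^ card (?V \<inter> H)" "2 ^ card (?V \<inter> N)" "card H"]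
    by (simp add: cardN mult.assoc mult.left_commute)
  \<comment> \<open>The extension captures at least one new value, as the later induction
    requires.\<close>
  obtain x where x: "x \<in> X" "x \<noteq> H"
    using X(2) unfolding oneQ by blast
  then obtain v where v: "v \<in> ?V" "x = h v"
    using X(1) unfolding h_vals[symmetric] by blast
  have "x \<in> B"
    unfolding B_def using x(1) by (rule generate.incl)
  then have "v \<in> ?V \<inter> N - H"
    using v x(2) vals_closed h_one[of v] by (auto simp: N_def)
  then have "\<not> ?V \<inter> N \<subseteq> H" by blast
  with N finN HN bound show thesis by (intro that)
qed

text \<open>The condition \<open>vals (full n) \<subseteq> H\<close> makes the quotient by
  \<open>H\<close> soluble and persists when \<open>H\<close> grows. Each extension captures a new
  value, so induction on the number of values outside \<open>H\<close> applies.\<close>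

lemma finite_normal_containing_values:
  assumes "H \<lhd> G" "finite H" "finite (vals t)" "vals (full n) \<subseteq> H"
  shows "\<exists>N. N \<lhd> G \<and> finite N \<and> vals t \<subseteq> N \<and>
    card N * 2 ^ card (vals t \<inter> H) \<le> card H * 2 ^ card (vals t)"
  using assms
proof (induction "card (vals t - H)" arbitrary: H rule: less_induct)
  case less
  show ?case
  proof (cases "vals t \<subseteq> H")
    case True
    then have "vals t \<inter> H = vals t" by blast
    with True less.prems show ?thesis by (intro exI[of _ H]) simp
  next
    case False
    with less.prems obtain M where M: "M \<lhd> G" "finite M" "H \<subseteq> M" "\<not> vals t \<inter> M \<subseteq> H"
      "card M * 2 ^ card (vals t \<inter> H) \<le> card H * 2 ^ card (vals t \<inter> M)"
      using extend_finite_normal[of H t n] by blast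
    have "card (vals t - M) < card (vals t - H)"
      using M less.prems by (intro psubset_card_mono) auto
    then obtain N where N: "N \<lhd> G" "finite N" "vals t \<subseteq> N"
      "card N * 2 ^ card (vals t \<inter> M) \<le> card M * 2 ^ card (vals t)"
      using less.hyps[of M] M less.prems by blast
    \<comment> \<open>The factor \<open>2 ^ card (vals t \<inter> M)\<close> lets the two ratio
      bounds be chained and is cancelled at the end.\<close>
    have "(card N * 2 ^ card (vals t \<inter> H)) * 2 ^ card (vals t \<inter> M)
        = (card N * 2 ^ card (vals t \<inter> M)) * 2 ^ card (vals t \<inter> H)"
      by simp
    also have "\<dots> \<le> (card M * 2 ^ card (vals t)) * 2 ^ card (vals t \<inter> H)"
      using N(4) by (intro mult_right_mono) auto
    also have "\<dots> = (card M * 2 ^ card (vals t \<inter> H)) * 2 ^ card (vals t)"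
      by simp
    also have "\<dots> \<le> (card H * 2 ^ card (vals t \<inter> M)) * 2 ^ card (vals t)"
      using M(5) by (intro mult_right_mono) auto
    also have "\<dots> = (card H * 2 ^ card (vals t)) * 2 ^ card (vals t \<inter> M)"
      by simp
    finally have "card N * 2 ^ card (vals t \<inter> H) \<le> card H * 2 ^ card (vals t)"
      by simp
    with N show ?thesis by blast
  qed
qed

end

section \<open>Orders of commutators\<close>

text \<open>The transfer homomorphism into a central point stabilizer maps \<open>d\<close> to \<open>d\<^sup>n\<close>, where \<open>n\<close> is the
  number of points.\<close>

locale central_action = group G for G (structure) +
  fixes act :: "'i \<Rightarrow> 'a \<Rightarrow> 'i" and I :: "'i set" and p0 :: 'i
  assumes finite_I: "finite I" and p0: "p0 \<in> I"
    and act_closed: "p \<in> I \<Longrightarrow> g \<in> carrier G \<Longrightarrow> act p g \<in> I"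
    and act_one: "p \<in> I \<Longrightarrow> act p \<one> = p"
    and act_mult: "p \<in> I \<Longrightarrow> g \<in> carrier G \<Longrightarrow> h \<in> carrier G \<Longrightarrow> act p (g \<otimes> h) = act (act p g) h"
    and transitive: "p \<in> I \<Longrightarrow> \<exists>g\<in>carrier G. act p0 g = p"
    and central: "z \<in> carrier G \<Longrightarrow> act p0 z = p0 \<Longrightarrow> g \<in> carrier G \<Longrightarrow> z \<otimes> g = g \<otimes> z"
begin

definition stab :: "'a set" where
  "stab = {z \<in> carrier G. act p0 z = p0}"

definition rep :: "'i \<Rightarrow> 'a" where
  "rep p = (SOME g. g \<in> carrier G \<and> act p0 g = p)"

text \<open>The transversal \<open>rep\<close> is not preserved by \<open>g\<close>; this
  correction, an element of the stabilizer, is the factor at \<open>p\<close> in the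
  transfer.\<close>

definition cocycle :: "'a \<Rightarrow> 'i \<Rightarrow> 'a" where
  "cocycle g p = rep p \<otimes> g \<otimes> inv (rep (act p g))"

abbreviation Z :: "('a, 'b) monoid_scheme" where
  "Z \<equiv> G\<lparr>carrier := stab\<rparr>"

lemma rep: "p \<in> I \<Longrightarrow> rep p \<in> carrier G" "p \<in> I \<Longrightarrow> act p0 (rep p) = p"
  using someI_ex[of "\<lambda>g. g \<in> carrier G \<and> act p0 g = p"] transitive[of p] by (auto simp: rep_def)

lemma act_inv_rep:
  assumes p: "p \<in> I" shows "act p (inv (rep p)) = p0"
  using rep[OF p] p0 act_mult[OF p0, of "rep p" "inv (rep p)"] by (simp add: act_one)

lemma act_inj:
  assumes "p \<in> I" "q \<in> I" "g \<in> carrier G" "act p g = act q g" shows "p = q"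
proof -
  have "act (act r g) (inv g) = r" if "r \<in> I" for r
    using that assms(3) by (simp add: act_one flip: act_mult)
  then show ?thesis using assms by metis
qed

lemma stab_subgroup: "subgroup stab G"
proof (rule subgroup.intro)
  show "inv x \<in> stab" if "x \<in> stab" for x
    using that act_mult[OF p0, of x "inv x"] p0 by (auto simp: stab_def act_one)
qed (use p0 in \<open>auto simp: stab_def act_one act_mult\<close>)

sublocale Z: comm_group Z
proof (rule group.group_comm_groupI)
  show "group Z"
    using stab_subgroup by (rule subgroup_imp_group)
qed (auto simp: stab_def central)

text \<open>The stabilizer of \<open>p\<close> is conjugate to \<open>stab\<close> by
  \<open>rep p\<close>, and a central subgroup equals its conjugates. Hence an element fixing one
  point fixes all.\<close>

lemma stab_iff:
  assumes p: "p \<in> I" and g: "g \<in> carrier G"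
  shows "act p g = p \<longleftrightarrow> g \<in> stab"
proof
  note r = rep[OF p]
  have conj: "act p0 (rep p \<otimes> g \<otimes> inv (rep p)) = act (act p g) (inv (rep p))"
    using r g p0 act_closed[OF p0] by (simp add: act_mult)

  assume "act p g = p"
  with conj act_inv_rep[OF p] have z: "act p0 (rep p \<otimes> g \<otimes> inv (rep p)) = p0" by simp
  define z where "z = rep p \<otimes> g \<otimes> inv (rep p)"
  have zc: "z \<in> carrier G" using r g by (simp add: z_def)
  have "g = inv (rep p) \<otimes> (z \<otimes> rep p)"
    using r g by (simp add: z_def m_assoc)
  also have "\<dots> = z"
    using central[OF zc, of "rep p"] z zc r by (simp add: z_def)
  finally show "g \<in> stab" using z zc by (simp add: stab_def z_def)
next
  note r = rep[OF p]
  assume "g \<in> stab"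
  then have g: "g \<in> carrier G" "act p0 g = p0" by (auto simp: stab_def)
  have "act p g = act p0 (rep p \<otimes> g)"
    using r g p0 by (simp add: act_mult)
  also have "\<dots> = act p0 (g \<otimes> rep p)"
    using central[OF g, of "rep p"] r by simp
  also have "\<dots> = p"
    using r g p0 by (simp add: act_mult)
  finally show "act p g = p" .
qed

lemma cocycle_closed:
  assumes p: "p \<in> I" and g: "g \<in> carrier G" shows "cocycle g p \<in> stab"
proof -
  let ?q = "act p g"
  have q: "?q \<in> I" using p g by (rule act_closed)
  have "act p0 (cocycle g p) = act (act p0 (rep ?q)) (inv (rep ?q))"
    using rep[OF p] rep[OF q] g p0 p by (simp add: cocycle_def act_mult act_closed)
  also have "\<dots> = p0"
    using rep[OF q] act_inv_rep[OF q] by simp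
  finally show ?thesis
    using rep[OF p] rep[OF q] g by (simp add: stab_def cocycle_def)
qed

lemma cocycle_mult:
  assumes "p \<in> I" "g \<in> carrier G" "h \<in> carrier G"
  shows "cocycle (g \<otimes> h) p = cocycle g p \<otimes> cocycle h (act p g)"
  using assms rep act_closed by (simp add: cocycle_def act_mult m_assoc)

definition transfer :: "'a \<Rightarrow> 'a" where
  "transfer g = finprod Z (cocycle g) I"

lemma transfer_closed: "g \<in> carrier G \<Longrightarrow> transfer g \<in> stab"
  using Z.finprod_closed[of "cocycle g" I] by (auto simp: transfer_def cocycle_closed)

text \<open>The element \<open>g\<close> permutes the points, so reindexing turns the product of
  shifted cocycles back into \<open>transfer h\<close>.\<close>

lemma transfer_mult:
  assumes g: "g \<in> carrier G" and h: "h \<in> carrier G"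
  shows "transfer (g \<otimes> h) = transfer g \<otimes> transfer h"
proof -
  have inj: "inj_on (\<lambda>p. act p g) I"
    using act_inj g by (auto simp: inj_on_def)
  then have img: "(\<lambda>p. act p g) ` I = I"
    using finite_I act_closed g by (intro endo_inj_surj) auto
  have "transfer (g \<otimes> h) = finprod Z (\<lambda>p. cocycle g p \<otimes>\<^bsub>Z\<^esub> cocycle h (act p g)) I"
    unfolding transfer_def using g h
    by (intro Z.finprod_cong refl)
      (auto simp: cocycle_mult simp_implies_def intro!: subgroup.m_closed[OF stab_subgroup] cocycle_closed act_closed)
  also have "\<dots> = transfer g \<otimes>\<^bsub>Z\<^esub> finprod Z (\<lambda>p. cocycle h (act p g)) I"
    unfolding transfer_def using g h
    by (intro Z.finprod_multf) (auto simp: cocycle_closed act_closed)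
  also have "finprod Z (\<lambda>p. cocycle h (act p g)) I = finprod Z (cocycle h) ((\<lambda>p. act p g) ` I)"
    using inj g h by (intro Z.finprod_reindex[symmetric]) (auto simp: cocycle_closed act_closed)
  finally show ?thesis by (simp add: img transfer_def)
qed

text \<open>A multiplicative map with central values kills commutators.\<close>

lemma transfer_com:
  assumes "a \<in> carrier G" "b \<in> carrier G" shows "transfer (com a b) = \<one>"
proof -
  have cl: "transfer a \<in> carrier G" "transfer b \<in> carrier G" "transfer (com a b) \<in> carrier G"
    and st: "transfer a \<in> stab"
    using assms transfer_closed by (auto simp: stab_def)
  have "a \<otimes> b = (b \<otimes> a) \<otimes> com a b"
    using assms by (simp add: commutator_def m_assoc)
  then have "transfer a \<otimes> transfer b = (transfer b \<otimes> transfer a) \<otimes> transfer (com a b)"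
    using assms by (metis com_closed m_closed transfer_mult)
  moreover have "transfer a \<otimes> transfer b = transfer b \<otimes> transfer a"
    using st cl central by (simp add: stab_def)
  ultimately show ?thesis
    using cl by (metis l_cancel_one m_closed)
qed

lemma act_pow_Suc: "p \<in> I \<Longrightarrow> d \<in> carrier G \<Longrightarrow> act p (d [^] Suc j) = act (act p (d [^] j)) d"
  by (simp add: act_mult)

text \<open>By \<open>cocycle_mult\<close> the product telescopes: intermediate representatives
  along the orbit cancel.\<close>

lemma finprod_cocycle_orbit:
  assumes "p \<in> I" "d \<in> carrier G"
  shows "finprod Z (\<lambda>j. cocycle d (act p (d [^] j))) {..<m::nat} = cocycle (d [^] m) p"
proof (induction m)
  case 0
  then show ?case using assms rep[OF assms(1)] by (simp add: cocycle_def act_one)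
next
  case (Suc m)
  have cl: "cocycle d (act p (d [^] j)) \<in> stab" for j :: nat
    using assms by (simp add: cocycle_closed act_closed)
  have "finprod Z (\<lambda>j. cocycle d (act p (d [^] j))) {..<Suc m}
      = cocycle d (act p (d [^] m)) \<otimes> cocycle (d [^] m) p"
    unfolding lessThan_Suc using cl Suc by (subst Z.finprod_insert) auto
  also have "\<dots> = cocycle (d [^] m) p \<otimes> cocycle d (act p (d [^] m))"
    using Z.m_comm[of "cocycle d (act p (d [^] m))" "cocycle (d [^] m) p"] cl assms cocycle_closed by simp
  also have "\<dots> = cocycle (d [^] Suc m) p"
    using assms by (simp add: cocycle_mult)
  finally show ?case .
qed

text \<open>All orbits of \<open>d\<close> have the same length \<open>e\<close>, as fixing one
  point means fixing all. Each contributes a conjugate of the central element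
  \<open>d [^] e\<close>, hence that element itself. Invariant subsets \<open>J\<close> are allowed
  so that orbits can be removed one by one.\<close>

lemma finprod_cocycle:
  assumes d: "d \<in> carrier G" and J: "J \<subseteq> I" "\<And>p. p \<in> J \<Longrightarrow> act p d \<in> J"
  shows "finprod Z (cocycle d) J = d [^] card J"
proof -
  have "range (\<lambda>j::nat. act p0 (d [^] j)) \<subseteq> I"
    using d p0 act_closed by auto
  then have "finite (range (\<lambda>j::nat. act p0 (d [^] j)))"
    using finite_I by (rule finite_subset)
  then have "\<not> inj (\<lambda>j::nat. act p0 (d [^] j))"
    using finite_imageD infinite_UNIV_nat by blast
  then obtain i j :: nat where ij: "act p0 (d [^] i) = act p0 (d [^] j)" "i < j"
    unfolding inj_def by (metis linorder_neqE_nat)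
  have diff: "d [^] (j - i) \<in> stab" if "p \<in> I" "act p (d [^] i) = act p (d [^] j)" "i < j" for p and i j :: nat
  proof -
    have "act (act p (d [^] (j - i))) (d [^] i) = act p (d [^] i)"
      using that d by (simp add: nat_pow_mult flip: act_mult)
    then have "act p (d [^] (j - i)) = p"
      by (rule act_inj[rotated 3]) (use that d act_closed in simp_all)
    then show ?thesis using that d stab_iff by simp
  qed
  define e where "e = (LEAST e::nat. 0 < e \<and> d [^] e \<in> stab)"
  have "\<exists>e::nat. 0 < e \<and> d [^] e \<in> stab"
    using diff[OF p0 ij] ij(2) by (intro exI[of _ "j - i"]) simp
  from LeastI_ex[OF this] have e: "0 < e" "d [^] e \<in> stab"
    by (simp_all add: e_def)
  have least: "d [^] m \<notin> stab" if "0 < m" "m < e" for m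
    using that not_less_Least[of m "\<lambda>e. 0 < e \<and> d [^] e \<in> stab"] by (auto simp: e_def)
  have "finite J" using J(1) finite_I by (rule finite_subset)
  then show ?thesis
    using J
  proof (induction J rule: finite_psubset_induct)
    case (psubset J)
    show ?case
    proof (cases "J = {}")
      case False
      then obtain p where p: "p \<in> J" "p \<in> I" using psubset.prems by blast
      define orb where "orb = (\<lambda>j::nat. act p (d [^] j)) ` {..<e}"
      have inj: "inj_on (\<lambda>j::nat. act p (d [^] j)) {..<e}"
      proof (rule linorder_inj_onI')
        fix i j assume "i \<in> {..<e}" "j \<in> {..<e}" "i < j"
        then show "act p (d [^] i) \<noteq> act p (d [^] j)"
          using diff[OF p(2), of i j] least[of "j - i"] by auto
      qed
      then have card_orb: "card orb = e" by (simp add: orb_def card_image)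
      have "act p (d [^] (j::nat)) \<in> J" for j
        using p d psubset.prems(2) by (induction j) (simp_all add: act_one act_mult)
      then have orb_J: "orb \<subseteq> J" by (auto simp: orb_def)
      have "p \<in> orb"
        unfolding orb_def using e p by (intro image_eqI[of _ _ 0]) (auto simp: act_one)
      \<comment> \<open>The complement of the orbit stays invariant because \<open>d\<close> acts
        injectively.\<close>
      have closed: "act q d \<in> J - orb" if q: "q \<in> J - orb" for q
      proof -
        have "act q d \<noteq> act p (d [^] j)" if "j < e" for j :: nat
        proof
          assume eq: "act q d = act p (d [^] j)"
          \<comment> \<open>Every orbit point is the image under \<open>d\<close> of an orbit point;
            the starting point wraps around to exponent \<open>e - 1\<close>.\<close>
          have "\<exists>i<e. act p (d [^] j) = act p (d [^] Suc i)"
          proof (cases j)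
            case 0
            then have "act p (d [^] j) = act p (d [^] e)"
              using stab_iff[OF p(2) nat_pow_closed[OF d], THEN iffD2, OF e(2)] p by (simp add: act_one)
            with e show ?thesis by (intro exI[of _ "e - 1"]) simp
          next
            case (Suc i)
            with that show ?thesis by (intro exI[of _ i]) simp
          qed
          then obtain i where i: "i < e" "act q d = act (act p (d [^] i)) d"
            unfolding eq using act_pow_Suc[OF p(2) d] by metis
          then have "q = act p (d [^] i)"
            by (intro act_inj[OF _ _ d i(2)]) (use q psubset.prems(1) p d act_closed in auto)
          with i(1) have "q \<in> orb" unfolding orb_def by blast
          with q show False by blast
        qed
        with q psubset.prems(2) show ?thesis by (auto simp: orb_def)
      qed
      have zcl: "cocycle d q \<in> stab" if "q \<in> J" for q
        using that psubset.prems(1) d cocycle_closed by blast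
      have "finprod Z (cocycle d) orb = finprod Z (\<lambda>j. cocycle d (act p (d [^] j))) {..<e}"
        unfolding orb_def using inj zcl orb_J by (intro Z.finprod_reindex) (auto simp: orb_def)
      also have "\<dots> = cocycle (d [^] e) p"
        using p(2) d by (rule finprod_cocycle_orbit)
      also have "\<dots> = rep p \<otimes> d [^] e \<otimes> inv (rep p)"
        using stab_iff[OF p(2), of "d [^] e"] e d by (simp add: cocycle_def)
      also have "\<dots> = d [^] e"
        using central[of "d [^] e" "rep p"] e(2) rep(1)[OF p(2)] d
        by (simp add: stab_def m_assoc flip: central)
      finally have orb: "finprod Z (cocycle d) orb = d [^] e" .
      have IH: "finprod Z (cocycle d) (J - orb) = d [^] card (J - orb)"
        using psubset.prems closed \<open>p \<in> orb\<close> p by (intro psubset.IH) auto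
      have "finprod Z (cocycle d) (orb \<union> (J - orb))
          = finprod Z (cocycle d) orb \<otimes>\<^bsub>Z\<^esub> finprod Z (cocycle d) (J - orb)"
        using psubset.hyps orb_J zcl finite_subset[OF orb_J] by (intro Z.finprod_Un_disjoint) auto
      also have "\<dots> = d [^] (e + card (J - orb))"
        using d by (simp add: orb IH nat_pow_mult)
      also have "e + card (J - orb) = card J"
        using card_Diff_subset[OF finite_subset[OF orb_J psubset.hyps(1)] orb_J] card_mono[OF psubset.hyps(1) orb_J] card_orb
        by simp
      also have "orb \<union> (J - orb) = J" using orb_J by blast
      finally show ?thesis .
    qed simp
  qed
qed

theorem com_power_card:
  assumes "a \<in> carrier G" "b \<in> carrier G" shows "com a b [^] card I = \<one>"
  using finprod_cocycle[of "com a b" I] transfer_com[OF assms] assms act_closed by (simp add: transfer_def)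


end

context group
begin

text \<open>The subgroup generated by \<open>a\<close> and \<open>b\<close> acts by conjugation on
  pairs. The stabilizer of \<open>(a, b)\<close> commutes with both generators and so is central,
  and the orbit lies in \<open>A \<times> A\<close>, which bounds the exponent from the
  transfer.\<close>

lemma com_power_bound:
  assumes A: "finite A" "A \<subseteq> carrier G" "\<And>x g. x \<in> A \<Longrightarrow> g \<in> carrier G \<Longrightarrow> inv g \<otimes> x \<otimes> g \<in> A"
    and a: "a \<in> A" and b: "b \<in> A"
  shows "\<exists>n::nat. 0 < n \<and> n \<le> (card A)\<^sup>2 \<and> com a b [^] n = \<one>"
proof -
  have ab: "a \<in> carrier G" "b \<in> carrier G" using a b A(2) by auto
  define H where "H = generate G {a, b}"
  have H: "subgroup H G"
    unfolding H_def using ab by (intro generate_is_subgroup) auto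
  then have Hc: "g \<in> carrier G" if "g \<in> H" for g
    using that subgroup.mem_carrier by metis
  have abH: "a \<in> H" "b \<in> H" by (auto simp: H_def intro: generate.incl)
  define act where "act p g = (inv g \<otimes> fst p \<otimes> g, inv g \<otimes> snd p \<otimes> g)" for p g
  define I where "I = act (a, b) ` H"
  let ?K = "G\<lparr>carrier := H\<rparr>"
  have sub: "I \<subseteq> A \<times> A"
    using A(3) a b Hc by (auto simp: I_def act_def)
  have mult: "act p (g \<otimes> h) = act (act p g) h"
    if "fst p \<in> carrier G" "snd p \<in> carrier G" "g \<in> carrier G" "h \<in> carrier G" for p g h
    using that by (simp add: act_def inv_mult_group m_assoc)
  have Ic: "fst p \<in> carrier G" "snd p \<in> carrier G" if "p \<in> I" for p
    using that sub A(2) by force+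
  interpret K: group ?K using H by (rule subgroup_imp_group)
  interpret K: central_action ?K act I "(a, b)"
  proof unfold_locales
    show finI: "finite I" using sub A(1) by (auto intro: finite_subset)
    show "(a, b) \<in> I"
      unfolding I_def using ab subgroup.one_closed[OF H] by (intro image_eqI[of _ _ \<one>]) (auto simp: act_def)
    fix p assume p: "p \<in> I"
    then obtain h where h: "h \<in> H" "p = act (a, b) h" by (auto simp: I_def)
    show "act p g \<in> I" if "g \<in> carrier ?K" for g
    proof -
      have "act p g = act (a, b) (h \<otimes> g)"
        using h that ab Hc by (simp add: mult)
      moreover have "h \<otimes> g \<in> H"
        using h that subgroup.m_closed[OF H] by simp
      ultimately show ?thesis unfolding I_def by blast
    qed
    show "act p \<one>\<^bsub>?K\<^esub> = p" using Ic[OF p] by (simp add: act_def)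
    show "act p (g \<otimes>\<^bsub>?K\<^esub> k) = act (act p g) k" if "g \<in> carrier ?K" "k \<in> carrier ?K" for g k
      using mult[OF Ic[OF p]] that Hc by simp
    show "\<exists>g\<in>carrier ?K. act (a, b) g = p" using h by auto
  next
    fix z g assume z: "z \<in> carrier ?K" "act (a, b) z = (a, b)" and g: "g \<in> carrier ?K"
    have zc: "z \<in> carrier G" using z Hc by simp
    have "inv z \<otimes> a \<otimes> z = a" "inv z \<otimes> b \<otimes> z = b"
      using z(2) by (auto simp: act_def)
    then have "com a z = \<one>" "com b z = \<one>"
      using conj_eq_mult_com[of a z] conj_eq_mult_com[of b z] ab zc by simp_all
    then have *: "com x z \<in> {\<one>}" if "x \<in> {a, b}" for x
      using that by blast
    have "com g z \<in> {\<one>}"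
      by (rule com_generate_left[OF one_is_normal _ zc *]) (use g ab H_def in auto)
    then show "z \<otimes>\<^bsub>?K\<^esub> g = g \<otimes>\<^bsub>?K\<^esub> z"
      using com_eq_one_iff[of g z] zc Hc g by simp
  qed
  have "commutator ?K a b = com a b"
    using abH H by (simp add: commutator_def m_inv_consistent)
  then have "com a b [^] card I = \<one>"
    using K.com_power_card[of a b] abH by (simp flip: nat_pow_consistent)
  moreover have "card I \<le> (card A)\<^sup>2"
    using card_mono[OF _ sub] A(1) by (simp add: card_cartesian_product power2_eq_square)
  moreover have "0 < card I"
    using K.p0 K.finite_I by (auto simp: card_gt_0_iff)
  ultimately show ?thesis by blast
qed

section \<open>Dietzmann's lemma\<close>

lemma generate_finite_order:
  assumes x: "x \<in> carrier G" and n: "0 < n" "x [^] (n::nat) = \<one>"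
  shows "finite (generate G {x, inv x})" "card (generate G {x, inv x}) \<le> n"
proof -
  let ?S = "(\<lambda>m::nat. x [^] m) ` {..<n}"
  have S: "x [^] m \<in> ?S" for m :: nat
  proof -
    have "x [^] m = (x [^] n) [^] (m div n) \<otimes> x [^] (m mod n)"
      using x by (simp only: nat_pow_pow nat_pow_mult) simp
    then show ?thesis using n x by simp
  qed
  have invx: "inv x = x [^] (n - 1)"
  proof -
    have "x [^] (n - 1) \<otimes> x = \<one>"
      using n x by (simp flip: nat_pow_Suc)
    then show ?thesis using x by (simp add: inv_equality)
  qed
  have "z \<in> ?S" if "z \<in> generate G {x, inv x}" for z
    using that
  proof induction
    case (eng u v)
    then obtain i j :: nat where "u = x [^] i" "v = x [^] j" by auto
    then show ?case using S[of "i + j"] x by (simp add: nat_pow_mult)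
  next
    case (inv h)
    then have "inv h = x [^] (n - 1) \<or> inv h = x [^] (1::nat)" unfolding invx[symmetric] using x by auto
    then show ?case using S[of "n - 1"] S[of 1] by (elim disjE) simp_all
  next
    case (incl h)
    then have "h = x [^] (n - 1) \<or> h = x [^] (1::nat)" unfolding invx[symmetric] using x by auto
    then show ?case using S[of "n - 1"] S[of 1] by (elim disjE) simp_all
  qed (use S[of 0] in simp)
  then have sub: "generate G {x, inv x} \<subseteq> ?S" by blast
  then show "finite (generate G {x, inv x})" by (rule finite_subset) simp
  show "card (generate G {x, inv x}) \<le> n"
    using card_mono[OF _ sub] card_image_le[of "{..<n}" "\<lambda>m::nat. x [^] m"] by simp
qed

definition list_prod :: "'a list \<Rightarrow> 'a" where
  "list_prod w = foldr (\<otimes>) w \<one>"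

lemma list_prod_simps [simp]: "list_prod [] = \<one>" "list_prod (x # w) = x \<otimes> list_prod w"
  by (simp_all add: list_prod_def)

lemma list_prod_closed: "set w \<subseteq> carrier G \<Longrightarrow> list_prod w \<in> carrier G"
  by (induction w) auto

lemma list_prod_append:
  "set u \<subseteq> carrier G \<Longrightarrow> set v \<subseteq> carrier G \<Longrightarrow> list_prod (u @ v) = list_prod u \<otimes> list_prod v"
  by (induction u) (auto simp: list_prod_closed m_assoc)

lemma generate_list_prod:
  assumes "D \<subseteq> carrier G" "\<And>x. x \<in> D \<Longrightarrow> inv x \<in> D" "z \<in> generate G D"
  shows "\<exists>w. set w \<subseteq> D \<and> z = list_prod w"
  using assms(3)
proof induction
  case one
  show ?case by (intro exI[of _ "[]"]) simp
next
  case (incl h)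
  then show ?case using assms(1) by (intro exI[of _ "[h]"]) auto
next
  case (inv h)
  then show ?case using assms by (intro exI[of _ "[inv h]"]) auto
next
  case (eng u v)
  then obtain a b where "set a \<subseteq> D" "u = list_prod a" "set b \<subseteq> D" "v = list_prod b" by blast
  then show ?case
    using assms(1) by (intro exI[of _ "a @ b"]) (auto simp: list_prod_append)
qed

text \<open>Replacing adjacent letters \<open>y x\<close> by \<open>x y\<^sup>x\<close> when the index of \<open>x\<close> is smaller than that of \<open>y\<close>
  decreases the list of indices lexicographically.\<close>

lemma sort_list_prod:
  fixes idx :: "'a \<Rightarrow> nat"
  assumes D: "D \<subseteq> carrier G" "\<And>x y. x \<in> D \<Longrightarrow> y \<in> D \<Longrightarrow> inv x \<otimes> y \<otimes> x \<in> D"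
    and w: "set w \<subseteq> D"
  shows "\<exists>v. set v \<subseteq> D \<and> sorted (map idx v) \<and> list_prod v = list_prod w"
  using w
proof (induction w rule: wf_induct_rule[OF wf_inv_image[OF wf_lex[OF wf_less_than], of "map idx"]])
  case (1 w)
  show ?case
  proof (cases "sorted (map idx w)")
    case False
    then obtain i where i: "Suc i < length w" "idx (w ! Suc i) < idx (w ! i)"
      by (auto simp: sorted_iff_nth_Suc not_le)
    define u y x v where "u = take i w" and "y = w ! i" and "x = w ! Suc i" and "v = drop (Suc (Suc i)) w"
    have w: "w = u @ y # x # v"
      using i by (simp add: u_def v_def x_def y_def Cons_nth_drop_Suc id_take_nth_drop[symmetric])
    let ?w = "u @ x # (inv x \<otimes> y \<otimes> x) # v"
    have setw: "set ?w \<subseteq> D" and xy: "x \<in> D" "y \<in> D" "set u \<subseteq> D" "set v \<subseteq> D"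
      using 1(2) D(2) unfolding w by auto
    have "(?w, w) \<in> inv_image (lex less_than) (map idx)"
      using i(2) unfolding x_def[symmetric] y_def[symmetric] by (auto simp: w intro!: lex_append_leftI)
    then obtain v' where v': "set v' \<subseteq> D" "sorted (map idx v')" "list_prod v' = list_prod ?w"
      using 1(1)[of ?w] setw by blast
    have cl: "x \<in> carrier G" "y \<in> carrier G" "set u \<subseteq> carrier G" "set v \<subseteq> carrier G"
      using xy D(1) by auto
    then have "list_prod ?w = list_prod w"
      unfolding w using list_prod_closed[OF cl(3)] list_prod_closed[OF cl(4)]
      by (simp add: list_prod_append m_assoc)
    with v' show ?thesis by auto
  qed (use 1 in blast)
qed

primrec partial_prod :: "(nat \<Rightarrow> 'a set) \<Rightarrow> nat \<Rightarrow> 'a set" where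
  "partial_prod C 0 = {\<one>}"
| "partial_prod C (Suc j) = partial_prod C j <#> C j"

lemma partial_prod_card:
  assumes "\<And>i. finite (C i)"
  shows "finite (partial_prod C j) \<and> card (partial_prod C j) \<le> (\<Prod>i<j. card (C i))"
proof (induction j)
  case (Suc j)
  have "partial_prod C (Suc j) = (\<lambda>(x, y). x \<otimes> y) ` (partial_prod C j \<times> C j)"
    by (auto simp: set_mult_def)
  moreover have "card ((\<lambda>(x, y). x \<otimes> y) ` (partial_prod C j \<times> C j)) \<le> card (partial_prod C j) * card (C j)"
    using card_image_le[of "partial_prod C j \<times> C j" "\<lambda>(x, y). x \<otimes> y"] Suc assms
    by (simp add: card_cartesian_product)
  moreover have "card (partial_prod C j) * card (C j) \<le> (\<Prod>i<Suc j. card (C i))"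
    using Suc by simp
  ultimately show ?case using Suc assms by (metis finite_SigmaI finite_imageI le_trans)
qed simp

text \<open>In a sorted word the letters of equal index are adjacent and multiply inside one
  \<open>C i\<close>. Induction from the right absorbs the last letter, of largest index; skipped
  indices cost nothing because each \<open>C i\<close> contains \<one>.\<close>

lemma list_prod_in_partial_prod:
  fixes idx :: "'a \<Rightarrow> nat"
  assumes C: "\<And>i. subgroup (C i) G" and D: "\<And>x. x \<in> D \<Longrightarrow> x \<in> C (idx x)"
    and w: "set w \<subseteq> D" "sorted (map idx w)" "\<And>x. x \<in> set w \<Longrightarrow> idx x < j"
  shows "list_prod w \<in> partial_prod C j"
proof -
  have closed: "partial_prod C j \<subseteq> carrier G" for j
    using C by (induction j) (auto simp: set_mult_def subset_iff dest: subgroup.mem_carrier)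
  have "partial_prod C j \<subseteq> partial_prod C (Suc j)" for j
  proof
    fix z assume z: "z \<in> partial_prod C j"
    then have "z = z \<otimes> \<one>" using closed[of j] by auto
    with z show "z \<in> partial_prod C (Suc j)"
      unfolding partial_prod.simps set_mult_def using subgroup.one_closed[OF C[of j]] by blast
  qed
  then have mono: "i \<le> j \<Longrightarrow> partial_prod C i \<subseteq> partial_prod C j" for i j
    by (rule lift_Suc_mono_le)
  have one: "\<one> \<in> partial_prod C j" for j
    using mono[of 0 j] by auto
  show ?thesis
    using w
  proof (induction w arbitrary: j rule: rev_induct)
    case Nil
    then show ?case using one by simp
  next
    case (snoc x w)
    have x: "x \<in> C (idx x)" "x \<in> carrier G"
      using snoc.prems(1) D[of x] subgroup.mem_carrier[OF C] by auto
    have wc: "set w \<subseteq> carrier G"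
      using snoc.prems(1) D subgroup.mem_carrier[OF C] by fastforce
    have "list_prod w \<in> partial_prod C (Suc (idx x))"
      using snoc.prems by (intro snoc.IH) (auto simp: sorted_append less_Suc_eq_le)
    then obtain p c where pc: "p \<in> partial_prod C (idx x)" "c \<in> C (idx x)" "list_prod w = p \<otimes> c"
      by (auto simp: set_mult_def)
    have "list_prod (w @ [x]) = p \<otimes> (c \<otimes> x)"
      using pc x closed[of "idx x"] subgroup.mem_carrier[OF C pc(2)] wc
      by (auto simp: list_prod_append m_assoc)
    moreover have "c \<otimes> x \<in> C (idx x)"
      using pc x subgroup.m_closed[OF C] by blast
    ultimately have "list_prod (w @ [x]) \<in> partial_prod C (Suc (idx x))"
      using pc(1) by (auto simp: set_mult_def)
    moreover have "Suc (idx x) \<le> j"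
      using snoc.prems(3)[of x] by simp
    ultimately show ?case using mono by blast
  qed
qed

text \<open>Dietzmann's lemma, where each pair of mutually inverse elements contributes one cyclic factor.\<close>

lemma card_generate_inverse_closed:
  assumes D: "finite D" "D \<subseteq> carrier G" "\<And>x y. x \<in> D \<Longrightarrow> y \<in> D \<Longrightarrow> inv x \<otimes> y \<otimes> x \<in> D"
      "\<And>x. x \<in> D \<Longrightarrow> inv x \<in> D"
    and t: "2 \<le> t"
    and ord: "\<And>x. x \<in> D \<Longrightarrow> \<exists>n::nat. 0 < n \<and> n \<le> t\<^sup>2 \<and> x [^] n = \<one>"
  shows "finite (generate G D) \<and> card (generate G D) \<le> t ^ card D"
proof -
  obtain f where f: "bij_betw f D {..<card D}"
    using ex_bij_betw_finite_nat[OF D(1)] by (auto simp: atLeast0LessThan)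
  have f_inj: "f x = f y \<longleftrightarrow> x = y" if "x \<in> D" "y \<in> D" for x y
    using f that by (auto simp: bij_betw_def inj_on_def)
  \<comment> \<open>The minimum gives \<open>x\<close> and \<open>inv x\<close> the same index,
    which no other element of \<open>D\<close> shares.\<close>
  define idx where "idx x = min (f x) (f (inv x))" for x
  define cls where "cls i = {x \<in> D. idx x = i}" for i
  define C where "C i = generate G (cls i)" for i
  have idx_less: "idx x < card D" if "x \<in> D" for x
    using bij_betwE[OF f] that by (auto simp: idx_def min_less_iff_disj)
  have cls: "cls (idx x) = {x, inv x}" if x: "x \<in> D" for x
  proof -
    have xc: "x \<in> carrier G" using x D(2) by blast
    have "y = x \<or> y = inv x" if y: "y \<in> D" "idx y = idx x" for y
    proof -
      have "y \<in> carrier G" using y D(2) by blast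
      then show ?thesis
        using y x xc D(4) f_inj unfolding idx_def min_def by (metis inv_inv)
    qed
    moreover have "idx (inv x) = idx x" using xc by (simp add: idx_def min.commute)
    ultimately show ?thesis using x D(4) by (auto simp: cls_def)
  qed
  have C_card: "finite (C i) \<and> card (C i) \<le> t ^ card (cls i)" for i
  proof (cases "cls i = {}")
    case True
    then show ?thesis by (simp add: C_def generate_empty)
  next
    case False
    then obtain x where x: "x \<in> D" "idx x = i" by (auto simp: cls_def)
    have xc: "x \<in> carrier G" using x D(2) by blast
    have C: "C i = generate G {x, inv x}" using cls[OF x(1)] x(2) by (simp add: C_def)
    show ?thesis
    \<comment> \<open>A self-inverse element forms a class of size 1, where 2 \<le> t suffices; a
      proper pair has size 2, matching the order bound \<open>t\<^sup>2\<close>.\<close>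
    proof (cases "x = inv x")
      case True
      then have "x \<otimes> x = \<one>" using xc by (metis l_inv)
      then have "x [^] (2::nat) = \<one>" using xc by (simp add: numeral_2_eq_2)
      moreover have "cls i = {x}" using cls[OF x(1)] x(2) True by simp
      ultimately show ?thesis
        using generate_finite_order[OF xc, of 2] t by (simp add: C)
    next
      case False
      then have "card (cls i) = 2" using cls[OF x(1)] x(2) by simp
      moreover obtain n :: nat where "0 < n" "n \<le> t\<^sup>2" "x [^] n = \<one>" using ord[OF x(1)] by blast
      ultimately show ?thesis
        using generate_finite_order[OF xc, of n] by (auto simp: C)
    qed
  qed
  have cls_sub: "cls i \<subseteq> carrier G" for i using D(2) by (auto simp: cls_def)
  have "generate G D \<subseteq> partial_prod C (card D)"
  proof
    fix z assume "z \<in> generate G D"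
    then obtain w where "set w \<subseteq> D" "z = list_prod w"
      using generate_list_prod[OF D(2,4)] by blast
    then obtain v where v: "set v \<subseteq> D" "sorted (map idx v)" "z = list_prod v"
      using sort_list_prod[OF D(2,3), of w idx] by auto
    have "list_prod v \<in> partial_prod C (card D)"
    proof (rule list_prod_in_partial_prod[OF _ _ v(1,2)])
      show "subgroup (C i) G" for i unfolding C_def using cls_sub by (rule generate_is_subgroup)
      show "x \<in> C (idx x)" if "x \<in> D" for x
        using that by (auto simp: C_def cls_def intro: generate.incl)
    qed (use v(1) idx_less in auto)
    then show "z \<in> partial_prod C (card D)" using v(3) by simp
  qed
  moreover have P: "finite (partial_prod C (card D))" "card (partial_prod C (card D)) \<le> (\<Prod>i<card D. card (C i))"
    using partial_prod_card[of C "card D"] C_card by auto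
  ultimately have "finite (generate G D)" "card (generate G D) \<le> (\<Prod>i<card D. card (C i))"
    using finite_subset[OF _ P(1)] order_trans[OF card_mono[OF P(1)] P(2)] by blast+
  moreover have "(\<Prod>i<card D. card (C i)) \<le> (\<Prod>i<card D. t ^ card (cls i))"
    using C_card by (intro prod_mono) auto
  moreover have "(\<Prod>i<card D. t ^ card (cls i)) = t ^ card D"
  proof -
    have "card D = card (\<Union>i<card D. cls i)"
      using idx_less by (intro arg_cong[of _ _ card]) (auto simp: cls_def)
    also have "\<dots> = (\<Sum>i<card D. card (cls i))"
      using D(1) by (intro card_UN_disjoint) (auto simp: cls_def)
    finally show ?thesis
      unfolding power_sum[symmetric] by (rule arg_cong[OF sym])
  qed
  ultimately show ?thesis by simp
qed

end

section \<open>Outer commutator words\<close>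

primrec height :: "comm_tree \<Rightarrow> nat" where
  "height (Leaf i) = 0"
| "height (Node s t) = Suc (max (height s) (height t))"

context group
begin

text \<open>A leaf of \<open>t\<close> admits every group element, in particular a value of any full
  subtree, so a full tree at least as high as \<open>t\<close> merely refines
  \<open>t\<close>.\<close>

lemma vals_full_subset: "height t \<le> k \<Longrightarrow> vals (full k) \<subseteq> vals t"
proof (induction t arbitrary: k)
  case (Leaf i)
  then show ?case using vals_closed by simp
next
  case (Node s t)
  then obtain j where "k = Suc j" "height s \<le> j" "height t \<le> j"
    by (cases k) auto
  with Node.IH[of j] show ?case by auto
qed

lemma word_value_cong:
  "(\<And>i. i \<in> indeterminates w \<Longrightarrow> g i = h i) \<Longrightarrow> word_value G w g = word_value G w h"
  by (induction w) (auto simp: word_value_def letter_value_def indeterminates_def)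

text \<open>\<open>word_value_hom\<close> requires an assignment into the group at every index; off
  the indeterminates it can be filled with \<one>.\<close>

lemma word_values_eq: "word_values G w = {word_value G w g | g. range g \<subseteq> carrier G}"
proof (intro equalityI subsetI)
  fix x assume "x \<in> word_values G w"
  then obtain g where g: "\<forall>i\<in>indeterminates w. g i \<in> carrier G" "x = word_value G w g"
    by (auto simp: word_values_def)
  define h where "h i = (if i \<in> indeterminates w then g i else \<one>)" for i
  have "word_value G w g = word_value G w h" "range h \<subseteq> carrier G"
    using g(1) by (auto simp: h_def intro: word_value_cong)
  with g(2) show "x \<in> {word_value G w g | g. range g \<subseteq> carrier G}" by blast
qed (auto simp: word_values_def)

lemma outer_commutator_word_values:
  assumes "outer_commutator_word \<omega>" shows "\<exists>t. word_values G \<omega> = vals t"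
  using assms
proof induction
  case (indeterminate i)
  have "word_value G [(i, True)] g = g i" if "range g \<subseteq> carrier G" for g
    using that by (simp add: word_value_def letter_value_def image_subset_iff)
  then have "word_values G [(i, True)] = {g i | g. range g \<subseteq> carrier G}"
    unfolding word_values_eq by (intro Collect_cong ex_cong1) auto
  also have "\<dots> = carrier G"
  proof (intro equalityI subsetI)
    fix x assume "x \<in> carrier G"
    then have "range (\<lambda>_::nat. x) \<subseteq> carrier G" by auto
    then show "x \<in> {g i | g. range g \<subseteq> carrier G}"
      by (intro CollectI exI[of _ "\<lambda>_. x"]) simp
  qed auto
  finally show ?case by (intro exI[of _ "Leaf 0"]) simp
next
  case (commutator \<alpha> \<beta>)
  then obtain s t where st: "word_values G \<alpha> = vals s" "word_values G \<beta> = vals t" by blast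
  have val: "word_value G (commutator free_group \<alpha> \<beta>) g = com (word_value G \<alpha> g) (word_value G \<beta> g)"
    if "range g \<subseteq> carrier G" for g
  proof -
    interpret h: group_hom free_group G "\<lambda>w. word_value G w g"
      using that by (intro group_hom.intro group_free_group is_group group_hom_axioms.intro word_value_hom)
    show ?thesis
      using commutator.hyps outer_commutator_word_in_free_group by (intro h.hom_commutator) auto
  qed
  have "word_values G (commutator free_group \<alpha> \<beta>) = vals (Node s t)"
  proof (intro equalityI subsetI)
    fix x assume "x \<in> word_values G (commutator free_group \<alpha> \<beta>)"
    then obtain g where g: "range g \<subseteq> carrier G" "x = com (word_value G \<alpha> g) (word_value G \<beta> g)"
      by (auto simp: word_values_eq val)
    then show "x \<in> vals (Node s t)"
      unfolding tree_values.simps st[symmetric] word_values_eq by blast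
  next
    fix x assume "x \<in> vals (Node s t)"
    then obtain g h where gh: "range g \<subseteq> carrier G" "range h \<subseteq> carrier G"
      "x = com (word_value G \<alpha> g) (word_value G \<beta> h)"
      unfolding tree_values.simps st[symmetric] word_values_eq by blast
    \<comment> \<open>Disjointness of the indeterminates lets the two assignments be glued without
      changing either value.\<close>
    define k where "k i = (if i \<in> indeterminates \<alpha> then g i else h i)" for i
    have k: "range k \<subseteq> carrier G" using gh by (auto simp: k_def)
    have "word_value G \<alpha> k = word_value G \<alpha> g" "word_value G \<beta> k = word_value G \<beta> h"
      using commutator.hyps(3) by (auto intro!: word_value_cong simp: k_def)
    with val[OF k] gh(3) have "x = word_value G (commutator free_group \<alpha> \<beta>) k" by simp
    with k show "x \<in> word_values G (commutator free_group \<alpha> \<beta>)"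
      unfolding word_values_eq by blast
  qed
  then show ?case by blast
qed

section \<open>The soluble and the insoluble bound\<close>

lemma card_generate_vals_solvable:
  assumes "finite (vals t)" "solvable G"
  shows "finite (generate G (vals t)) \<and> card (generate G (vals t)) \<le> 2 ^ (card (vals t) - 1)"
proof -
  obtain n where "vals (full n) \<subseteq> {\<one>}"
    using assms(2) solvable_iff_full_values by blast
  then obtain N where N: "N \<lhd> G" "finite N" "vals t \<subseteq> N"
    "card N * 2 ^ card (vals t \<inter> {\<one>}) \<le> card {\<one>} * 2 ^ card (vals t)"
    using finite_normal_containing_values[OF one_is_normal _ assms(1)] by blast
  \<comment> \<open>The trivial starting subgroup contains exactly one value, which supplies the -1
    in the exponent.\<close>
  have "vals t \<inter> {\<one>} = {\<one>}" using one_in_vals by blast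
  with N(4) have "card N * 2 \<le> 2 ^ card (vals t)" by simp
  moreover have "card (vals t) = Suc (card (vals t) - 1)"
    using card.remove[OF assms(1) one_in_vals] by simp
  ultimately have "card N * 2 \<le> 2 ^ (card (vals t) - 1) * 2"
    by (metis mult.commute power_Suc)
  moreover have sub: "generate G (vals t) \<subseteq> N"
    using N by (intro generate_subgroup_incl normal_imp_subgroup)
  ultimately show ?thesis
    using card_mono[OF N(2) sub] finite_subset[OF sub N(2)] by simp
qed

lemma card_generate_vals_not_solvable:
  assumes fin: "finite (vals t)" and "\<not> solvable G"
  shows "finite (generate G (vals t)) \<and>
    card (generate G (vals t)) \<le> (card (vals t) - 1) ^ (card (vals t) - 1)"
proof -
  define k where "k = height t"
  define A where "A = vals t - {\<one>}"
  \<comment> \<open>Level \<open>Suc k\<close> makes each element of \<open>D\<close> a commutator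
    of two values of \<open>full k\<close>, which are themselves values of \<open>t\<close>.\<close>
  define D where "D = vals (full (Suc k)) - {\<one>}"
  define r where "r = card A"
  have card_V: "card (vals t) = Suc r"
    using card.remove[OF fin one_in_vals] by (simp add: r_def A_def)
  have A: "finite A" "A \<subseteq> carrier G" "\<And>x g. x \<in> A \<Longrightarrow> g \<in> carrier G \<Longrightarrow> inv g \<otimes> x \<otimes> g \<in> A"
    using fin vals_closed[of t] vals_conj[of _ t] normal_conj_iff[OF one_is_normal]
    by (auto simp: A_def)
  have sub: "vals (full k) \<subseteq> vals t" and DA: "D \<subseteq> A"
    using vals_full_subset[of t k] vals_full_subset[of t "Suc k"] by (auto simp: A_def D_def k_def)
  have D_com: "\<exists>a\<in>A. \<exists>b\<in>A. d = com a b" if "d \<in> D" for d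
  proof -
    from that obtain a b where ab: "a \<in> vals (full k)" "b \<in> vals (full k)" "d = com a b" "d \<noteq> \<one>"
      by (auto simp: D_def)
    then have "a \<in> carrier G" "b \<in> carrier G" using vals_closed by blast+
    with ab(3,4) have "a \<noteq> \<one>" "b \<noteq> \<one>" by auto
    with ab sub show ?thesis by (auto simp: A_def)
  qed
  \<comment> \<open>A sole nontrivial value would be fixed by conjugation, so commutators of
    elements of \<open>A\<close> would vanish, leaving \<open>D\<close> empty and the group
    soluble.\<close>
  have r: "2 \<le> r"
  proof (rule ccontr)
    assume "\<not> 2 \<le> r"
    then have single: "x = y" if "x \<in> A" "y \<in> A" for x y
      using that A(1) card_le_Suc0_iff_eq[of A] by (auto simp: r_def)
    have "com a b = \<one>" if a: "a \<in> A" and b: "b \<in> A" for a b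
    proof -
      have ab: "a \<in> carrier G" "b \<in> carrier G" using a b A(2) by auto
      then have "a \<otimes> com a b = a"
        using single[OF A(3)[OF a] a, of b] by (simp add: conj_eq_mult_com)
      then show ?thesis using ab by simp
    qed
    with D_com have "D = {}" by (auto simp: D_def)
    then have "vals (full (Suc k)) \<subseteq> {\<one>}" by (simp only: D_def Diff_eq_empty_iff)
    with assms(2) show False using solvable_iff_full_values by blast
  qed
  have D: "D \<subseteq> carrier G" "finite D"
    using DA A finite_subset by auto
  have D_conj: "inv g \<otimes> x \<otimes> g \<in> D" if "x \<in> D" "g \<in> carrier G" for x g
    using that D vals_conj[of x "full (Suc k)" g] normal_conj_iff[OF one_is_normal, of x g]
    by (auto simp: D_def simp del: full.simps)
  have D_inv: "inv x \<in> D" if x: "x \<in> D" for x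
  proof -
    from x obtain a b where ab: "a \<in> vals (full k)" "b \<in> vals (full k)" "x = com a b"
      by (auto simp: D_def)
    moreover have "a \<in> carrier G" "b \<in> carrier G" using ab vals_closed by blast+
    ultimately have "inv x \<in> vals (full (Suc k))" by (auto simp: inv_com)
    then show ?thesis using x D(1) by (auto simp: D_def simp del: full.simps)
  qed
  define H where "H = generate G D"
  have H: "H \<lhd> G"
    unfolding H_def using D(1) D_conj by (rule normal_generate)
  \<comment> \<open>Dietzmann's lemma applies with base \<open>r\<close>: the transfer bounds the
    orders of elements of \<open>D\<close> by \<open>r\<^sup>2\<close>.\<close>
  have "finite H \<and> card H \<le> r ^ card D"
    unfolding H_def
  proof (rule card_generate_inverse_closed[OF D(2,1) _ D_inv r])
    show "inv x \<otimes> y \<otimes> x \<in> D" if "x \<in> D" "y \<in> D" for x y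
      using that D D_conj by blast
    show "\<exists>n. 0 < n \<and> n \<le> r\<^sup>2 \<and> x [^] (n::nat) = \<one>" if "x \<in> D" for x
      using D_com[OF that] com_power_bound[OF A] by (auto simp: r_def)
  qed
  then have finH: "finite H" and cardH: "card H \<le> r ^ card D" by auto
  have oneH: "\<one> \<in> H" and DH: "D \<subseteq> H"
    by (auto simp: H_def intro: generate.intros)
  \<comment> \<open>Thus the quotient by \<open>H\<close> is soluble and the extension argument can
    start from \<open>H\<close>.\<close>
  then have "vals (full (Suc k)) \<subseteq> H"
    unfolding D_def by blast
  then obtain N where N: "N \<lhd> G" "finite N" "vals t \<subseteq> N"
    "card N * 2 ^ card (vals t \<inter> H) \<le> card H * 2 ^ card (vals t)"
    using finite_normal_containing_values[OF H finH fin] by blast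
  have "\<one> \<notin> D" by (simp add: D_def)
  \<comment> \<open>The value \<one>, counted besides \<open>D\<close>, offsets the extra factor 2
    in \<open>2 ^ Suc r\<close>.\<close>
  then have "Suc (card D) = card (insert \<one> D)"
    using D(2) by simp
  also have "\<dots> \<le> card (vals t \<inter> H)"
    using fin DA DH oneH one_in_vals by (intro card_mono) (auto simp: A_def)
  finally have "card N * 2 ^ Suc (card D) \<le> card N * 2 ^ card (vals t \<inter> H)"
    by (intro mult_left_mono power_increasing) auto
  also have "\<dots> \<le> r ^ card D * 2 ^ Suc r"
    using N(4) cardH unfolding card_V by (meson le_trans mult_le_mono1)
  finally have "card N * 2 ^ card D \<le> r ^ card D * 2 ^ r" by simp
  also have "2 ^ r = 2 ^ (r - card D) * (2::nat) ^ card D"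
    using card_mono[OF A(1) DA] by (simp add: r_def flip: power_add)
  \<comment> \<open>Since 2 \<le> r, the factor 2 for each nontrivial value outside \<open>D\<close>
    may be replaced by \<open>r\<close>, giving total exponent \<open>r\<close>.\<close>
  also have "r ^ card D * (2 ^ (r - card D) * 2 ^ card D) \<le> r ^ card D * (r ^ (r - card D) * 2 ^ card D)"
    using r by (intro mult_left_mono mult_right_mono power_mono) auto
  also have "\<dots> = r ^ r * 2 ^ card D"
    using card_mono[OF A(1) DA] by (simp add: r_def mult.assoc[symmetric] flip: power_add)
  finally have "card N \<le> r ^ r" by simp
  moreover have sub: "generate G (vals t) \<subseteq> N"
    using N by (intro generate_subgroup_incl normal_imp_subgroup)
  ultimately show ?thesis
    using card_mono[OF N(2) sub] finite_subset[OF sub N(2)] by (simp add: card_V)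
qed

end

theorem theoremA:
  fixes G :: "('a, 'b) monoid_scheme" and \<omega> :: "letter list" and m :: nat
  assumes "group G"
    and "outer_commutator_word \<omega>"
    and "finite (word_values G \<omega>)"
    and "card (word_values G \<omega>) = m"
  shows "(solvable G \<longrightarrow>
            finite (verbal_subgroup G \<omega>) \<and> card (verbal_subgroup G \<omega>) \<le> 2 ^ (m - 1)) \<and>
         (\<not> solvable G \<longrightarrow>
            finite (verbal_subgroup G \<omega>) \<and> card (verbal_subgroup G \<omega>) \<le> (m - 1) ^ (m - 1))"
proof -
  interpret group G by fact
  obtain t where "word_values G \<omega> = vals t"
    using outer_commutator_word_values[OF assms(2)] by blast
  then show ?thesis
    using card_generate_vals_solvable[of t] card_generate_vals_not_solvable[of t] assms(3,4)
    by (simp add: verbal_subgroup_def)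
qed

end
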